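(* Let $G$ be a finite group, suppose that $S$ is a Sylow $p$-subgroup of $G$, and let $\mathcal F:=\mathcal F_S(G)$. Define $A(G;p)$ to be the subring of $A(G)$ where all isotropy subgroups are $p$-groups. Then the transitive $G$-set $[G/S]$ is invertible in $A(G;p)_{(p)}$, and we get an isomorphism of rings $A(\mathcal F)_{(p)}\cong A(G;p)_{(p)}$ by $$\beta_P\mapsto\frac{[G/P]}{[G/S]}\qquad(P\le S).$$
   Context: Here $p$ is a prime. $\mathcal F_S(G)$ is the category whose objects are the subgroups of $S$ and whose morphism sets $\mathcal F(P,Q)$ are the sets of homomorphisms $P\to Q$ induced by conjugation by elements of $G$ (it is a saturated fusion system). $P,Q\le S$ are $\mathcal F$-conjugate ($P\sim_{\mathcal F}Q$) if they are isomorphic in $\mathcal F$, i.e. $G$-conjugate; $[P]_{\mathcal F}$ is the set of $\mathcal F$-conjugates of $P$ in $S$. $A(G)$ is the Burnside ring of a finite group $G$, with additive basis the transitive $G$-sets $[G/H]$, $H\le G$ up to conjugation; $A(G;p)$ is the subring (not necessarily containing the identity of $A(G)$) spanned by the $[G/P]$ with $P\le G$ a $p$-subgroup. The subscript $(p)$ denotes tensoring with $\mathbb Z_{(p)}$. Invertibility of $[G/S]$ in $A(G;p)_{(p)}$ includes the assertion that $A(G;p)_{(p)}$ has a multiplicative identity (which is in general different from the identity of $A(G)_{(p)}$). $\Phi_Q\colon A(S)_{(p)}\to\mathbb Z_{(p)}$ is the ring homomorphism counting $Q$-fixed points. $X\in A(S)_{(p)}$ is $\mathcal F$-stable if for all $P\le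 S$ and $\varphi\in\mathcal F(P,S)$ the restrictions of $X$ to $A(P)_{(p)}$ along $\varphi$ and along the inclusion agree; equivalently, $\Phi_P(X)=\Phi_Q(X)$ whenever $P\sim_{\mathcal F}Q$. $A(\mathcal F)_{(p)}$ is the subring of $\mathcal F$-stable elements of $A(S)_{(p)}$. For $P\le S$, $\beta_P\in A(\mathcal F)_{(p)}$ is the (existing, unique) element with $\Phi_Q(\beta_P)=\frac1{|[Q]_{\mathcal F}|}\sum_{Q'\in[Q]_{\mathcal F}}\Phi_{Q'}([S/P])$ for all $Q\le S$; it depends only on $P$ up to $\mathcal F$-conjugation, and the $\beta_P$, $P$ up to $\mathcal F$-conjugation, form a $\mathbb Z_{(p)}$-basis of $A(\mathcal F)_{(p)}$. *)

theory Defs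
  imports "HOL-Algebra.Group_Action" "HOL-Algebra.Left_Coset" "HOL-Algebra.Generated_Groups"
    "HOL-Algebra.QuotRing" HOL.Rat "HOL-Computational_Algebra.Primes"
begin

section \<open>Finite \<open>G\<close>-sets\<close>

type_synonym ('a, 'b) gset = "'b set \<times> ('a \<Rightarrow> 'b \<Rightarrow> 'b)"

definition fin_gset :: "('a, 'm) monoid_scheme \<Rightarrow> ('a, 'b) gset \<Rightarrow> bool" where
  "fin_gset G X \<longleftrightarrow> finite (fst X) \<and> group_action G (fst X) (snd X)"

definition gset_iso :: "('a, 'm) monoid_scheme \<Rightarrow> ('a, 'b) gset \<Rightarrow> ('a, 'c) gset \<Rightarrow> bool" where
  "gset_iso G X Y \<longleftrightarrow> (\<exists>f. bij_betw f (fst X) (fst Y) \<and>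
     (\<forall>g\<in>carrier G. \<forall>x\<in>fst X. f (snd X g x) = snd Y g (f x)))"

text \<open>The actions below are restricted to the underlying set because the permutation group
  \<^const>\<open>BijGroup\<close> consists of extensional functions.\<close>

definition gset_empty :: "('a, nat) gset" where
  "gset_empty = ({}, \<lambda>g. \<lambda>x\<in>{}. x)"

definition gset_point :: "('a, unit) gset" where
  "gset_point = (UNIV, \<lambda>g x. x)"

definition gset_sum :: "('a, 'b) gset \<Rightarrow> ('a, 'c) gset \<Rightarrow> ('a, 'b + 'c) gset" where
  "gset_sum X Y = (Sum_Type.Plus (fst X) (fst Y),
     \<lambda>g. restrict (map_sum (snd X g) (snd Y g)) (Sum_Type.Plus (fst X) (fst Y)))"

definition gset_prod :: "('a, 'b) gset \<Rightarrow> ('a, 'c) gset \<Rightarrow> ('a, 'b \<times> 'c) gset" where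
  "gset_prod X Y = (fst X \<times> fst Y,
     \<lambda>g. restrict (map_prod (snd X g) (snd Y g)) (fst X \<times> fst Y))"

definition gset_pullback :: "('h \<Rightarrow> 'a) \<Rightarrow> ('a, 'b) gset \<Rightarrow> ('h, 'b) gset" where
  "gset_pullback f X = (fst X, \<lambda>h. snd X (f h))"

definition gset_fixed :: "'a set \<Rightarrow> ('a, 'b) gset \<Rightarrow> 'b set" where
  "gset_fixed Q X = {x \<in> fst X. \<forall>q\<in>Q. snd X q x = x}"

definition gset_cosets :: "('a, 'm) monoid_scheme \<Rightarrow> 'a set \<Rightarrow> ('a, 'a set) gset" where
  "gset_cosets G H = (lcosets\<^bsub>G\<^esub> H, \<lambda>g. \<lambda>C\<in>lcosets\<^bsub>G\<^esub> H. g <#\<^bsub>G\<^esub> C)"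


section \<open>The Burnside ring\<close>

text \<open>The Grothendieck ring of the semiring of isomorphism classes of finite \<open>G\<close>-sets. Every finite
  \<open>G\<close>-set is isomorphic to one whose underlying set consists of natural numbers, so the
  representatives are taken from these. The formal difference \<open>[X] - [Y]\<close> is the set of all pairs
  \<open>(X', Y')\<close> of such representatives with \<open>X + Y' + Z \<cong> X' + Y + Z\<close> for some finite \<open>Z\<close>;
  here \<open>X\<close> and \<open>Y\<close> may live on arbitrary types.\<close>

type_synonym 'a virt = "(('a, nat) gset \<times> ('a, nat) gset) set"

definition gset_diff :: "('a, 'm) monoid_scheme \<Rightarrow> ('a, 'b) gset \<Rightarrow> ('a, 'c) gset \<Rightarrow> 'a virt" where
  "gset_diff G X Y = {(X', Y'). fin_gset G X' \<and> fin_gset G Y' \<and>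
     (\<exists>Z :: ('a, nat) gset. fin_gset G Z \<and>
        gset_iso G (gset_sum (gset_sum X Y') Z) (gset_sum (gset_sum X' Y) Z))}"

abbreviation gset_class :: "('a, 'm) monoid_scheme \<Rightarrow> ('a, 'b) gset \<Rightarrow> 'a virt" where
  "gset_class G X \<equiv> gset_diff G X gset_empty"

definition burnside :: "('a, 'm) monoid_scheme \<Rightarrow> 'a virt ring" where
  "burnside G = \<lparr>
     carrier = {gset_diff G X Y | (X :: ('a, nat) gset) (Y :: ('a, nat) gset).
                  fin_gset G X \<and> fin_gset G Y},
     monoid.mult = (\<lambda>c d. \<Union>(X, Y)\<in>c. \<Union>(X', Y')\<in>d.
               gset_diff G (gset_sum (gset_prod X X') (gset_prod Y Y'))
                           (gset_sum (gset_prod X Y') (gset_prod Y X'))),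
     one = gset_class G gset_point,
     zero = gset_class G gset_empty,
     add = (\<lambda>c d. \<Union>(X, Y)\<in>c. \<Union>(X', Y')\<in>d. gset_diff G (gset_sum X X') (gset_sum Y Y'))\<rparr>"

definition trans_class :: "('a, 'm) monoid_scheme \<Rightarrow> 'a set \<Rightarrow> 'a virt" where
  "trans_class G H = gset_class G (gset_cosets G H)"

definition p_subgroup :: "nat \<Rightarrow> 'a set \<Rightarrow> ('a, 'm) monoid_scheme \<Rightarrow> bool" where
  "p_subgroup p P G \<longleftrightarrow> subgroup P G \<and> (\<exists>n. card P = p ^ n)"

definition sylow_subgroup :: "nat \<Rightarrow> 'a set \<Rightarrow> ('a, 'm) monoid_scheme \<Rightarrow> bool" where
  "sylow_subgroup p S G \<longleftrightarrow> subgroup S G \<and> card S = p ^ multiplicity p (order G)"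

text \<open>\<open>A(G;p)\<close>. The field \<^const>\<open>one\<close> is inherited from \<open>A(G)\<close> and carries no meaning here: it need not
  lie in the carrier.\<close>

definition burnside_p :: "nat \<Rightarrow> ('a, 'm) monoid_scheme \<Rightarrow> 'a virt ring" where
  "burnside_p p G = (burnside G)\<lparr>carrier :=
     generate (add_monoid (burnside G)) {trans_class G P | P. p_subgroup p P G}\<rparr>"

definition mark :: "'a set \<Rightarrow> 'a virt \<Rightarrow> int" where
  "mark Q c = the_elem ((\<lambda>(X, Y). int (card (gset_fixed Q X)) - int (card (gset_fixed Q Y))) ` c)"

definition burnside_res :: "('h, 'm) monoid_scheme \<Rightarrow> ('h \<Rightarrow> 'a) \<Rightarrow> 'a virt \<Rightarrow> 'h virt" where
  "burnside_res P f c = (\<Union>(X, Y)\<in>c. gset_diff P (gset_pullback f X) (gset_pullback f Y))"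


section \<open>Localization at \<open>p\<close>\<close>

text \<open>\<open>R \<otimes> \<int>\<^sub>(\<^sub>p\<^sub>)\<close> as the module of fractions \<open>a / n\<close> with \<open>n\<close> a (positive) integer prime to \<open>p\<close>.
  The ring \<open>R\<close> may lack an identity; then the field \<^const>\<open>one\<close> of the result carries no meaning.\<close>

definition loc_frac :: "nat \<Rightarrow> ('r, 'm) ring_scheme \<Rightarrow> 'r \<Rightarrow> nat \<Rightarrow> ('r \<times> nat) set" where
  "loc_frac p R a n = {(b, m). b \<in> carrier R \<and> coprime m p \<and>
     (\<exists>k::nat. coprime k p \<and> [(k * m)] \<cdot>\<^bsub>R\<^esub> a = [(k * n)] \<cdot>\<^bsub>R\<^esub> b)}"

definition localize :: "nat \<Rightarrow> ('r, 'm) ring_scheme \<Rightarrow> ('r \<times> nat) set ring" where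
  "localize p R = \<lparr>
     carrier = {loc_frac p R a n | a n. a \<in> carrier R \<and> coprime n p},
     monoid.mult = (\<lambda>x y. \<Union>(a, n)\<in>x. \<Union>(b, m)\<in>y. loc_frac p R (a \<otimes>\<^bsub>R\<^esub> b) (n * m)),
     one = loc_frac p R \<one>\<^bsub>R\<^esub> 1,
     zero = loc_frac p R \<zero>\<^bsub>R\<^esub> 1,
     add = (\<lambda>x y. \<Union>(a, n)\<in>x. \<Union>(b, m)\<in>y.
              loc_frac p R ([m] \<cdot>\<^bsub>R\<^esub> a \<oplus>\<^bsub>R\<^esub> [n] \<cdot>\<^bsub>R\<^esub> b) (n * m))\<rparr>"

text \<open>The values of \<open>\<Phi>\<^sub>Q\<close> lie in \<open>\<int>\<^sub>(\<^sub>p\<^sub>)\<close>, viewed inside the rationals.\<close>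

definition loc_mark :: "'a set \<Rightarrow> ('a virt \<times> nat) set \<Rightarrow> rat" where
  "loc_mark Q x = the_elem ((\<lambda>(a, n). of_int (mark Q a) / of_nat n) ` x)"

definition loc_res ::
    "nat \<Rightarrow> ('h, 'm) monoid_scheme \<Rightarrow> ('h \<Rightarrow> 'a) \<Rightarrow> ('a virt \<times> nat) set \<Rightarrow> ('h virt \<times> nat) set" where
  "loc_res p P f x = (\<Union>(a, n)\<in>x. loc_frac p (burnside P) (burnside_res P f a) n)"


section \<open>The fusion system \<open>\<F>\<^sub>S(G)\<close> and its Burnside ring\<close>

definition fusion_mor :: "('a, 'm) monoid_scheme \<Rightarrow> 'a set \<Rightarrow> 'a set \<Rightarrow> ('a \<Rightarrow> 'a) set" where
  "fusion_mor G P Q = {\<lambda>x\<in>P. g \<otimes>\<^bsub>G\<^esub> x \<otimes>\<^bsub>G\<^esub> inv\<^bsub>G\<^esub> g | g.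
     g \<in> carrier G \<and> (\<forall>x\<in>P. g \<otimes>\<^bsub>G\<^esub> x \<otimes>\<^bsub>G\<^esub> inv\<^bsub>G\<^esub> g \<in> Q)}"

definition fusion_conj :: "('a, 'm) monoid_scheme \<Rightarrow> 'a set \<Rightarrow> 'a set \<Rightarrow> bool" where
  "fusion_conj G P Q \<longleftrightarrow> (\<exists>\<phi>\<in>fusion_mor G P Q. \<exists>\<psi>\<in>fusion_mor G Q P.
     compose P \<psi> \<phi> = (\<lambda>x\<in>P. x) \<and> compose Q \<phi> \<psi> = (\<lambda>x\<in>Q. x))"

definition fusion_class :: "('a, 'm) monoid_scheme \<Rightarrow> 'a set \<Rightarrow> 'a set \<Rightarrow> 'a set set" where
  "fusion_class G S Q = {Q'. subgroup Q' G \<and> Q' \<subseteq> S \<and> fusion_conj G Q Q'}"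

definition fusion_stable ::
    "nat \<Rightarrow> ('a, 'm) monoid_scheme \<Rightarrow> 'a set \<Rightarrow> ('a virt \<times> nat) set \<Rightarrow> bool" where
  "fusion_stable p G S x \<longleftrightarrow> (\<forall>P. subgroup P G \<and> P \<subseteq> S \<longrightarrow> (\<forall>\<phi>\<in>fusion_mor G P S.
     loc_res p (G\<lparr>carrier := P\<rparr>) \<phi> x = loc_res p (G\<lparr>carrier := P\<rparr>) (\<lambda>y\<in>P. y) x))"

definition burnside_fusion ::
    "nat \<Rightarrow> ('a, 'm) monoid_scheme \<Rightarrow> 'a set \<Rightarrow> ('a virt \<times> nat) set ring" where
  "burnside_fusion p G S = (localize p (burnside (G\<lparr>carrier := S\<rparr>)))\<lparr>carrier :=
     {x \<in> carrier (localize p (burnside (G\<lparr>carrier := S\<rparr>))). fusion_stable p G S x}\<rparr>"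

definition beta ::
    "nat \<Rightarrow> ('a, 'm) monoid_scheme \<Rightarrow> 'a set \<Rightarrow> 'a set \<Rightarrow> ('a virt \<times> nat) set" where
  "beta p G S P = (THE x. x \<in> carrier (burnside_fusion p G S) \<and>
     (\<forall>Q. subgroup Q G \<and> Q \<subseteq> S \<longrightarrow>
        loc_mark Q x =
          (\<Sum>Q'\<in>fusion_class G S Q.
             loc_mark Q' (loc_frac p (burnside (G\<lparr>carrier := S\<rparr>)) (trans_class (G\<lparr>carrier := S\<rparr>) P) 1))
          / of_nat (card (fusion_class G S Q))))"

text \<open>The element \<open>[G/P]\<close> of \<open>A(G;p)\<^sub>(\<^sub>p\<^sub>)\<close>.\<close>

definition trans_class_p ::
    "nat \<Rightarrow> ('a, 'm) monoid_scheme \<Rightarrow> 'a set \<Rightarrow> ('a virt \<times> nat) set" where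
  "trans_class_p p G P = loc_frac p (burnside_p p G) (trans_class G P) 1"

end

theory Submission
  imports Defs "HOL-Library.Function_Algebras"
begin

text \<open>Everything is read off from the numbers of fixed points. By Burnside's theorem
  (\<open>marks_eq_imp_gset_iso\<close>) a finite \<open>G\<close>-set is determined up to isomorphism by its marks, that is,
  by the numbers of points fixed by the subgroups. Hence \<open>A(G)\<close> and its localizations are rings of
  rational functions on the set of subgroups, with pointwise operations. For the two rings of the
  theorem the marks at the subgroups of \<open>S\<close> suffice: \<open>A(\<F>)\<^sub>(\<^sub>p\<^sub>)\<close> consists of the functions in
  \<open>A(S)\<^sub>(\<^sub>p\<^sub>)\<close> that are constant on conjugacy classes under \<open>G\<close> (\<open>fusion_stable_iff\<close>), and the marks of an
  element of \<open>A(G;p)\<close> vanish outside the \<open>p\<close>-subgroups, each of which is conjugate to a subgroup of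
  \<open>S\<close>. The isomorphism is the one that preserves marks; what has to be shown is that both rings
  have the same functions (\<open>ghost_image_eq\<close>).

  Let \<open>u\<close> be the function of \<open>[G/S]\<close>. Restriction of \<open>G\<close>-sets to \<open>S\<close> does not change marks at
  subgroups of \<open>S\<close> and gives stable elements, so the functions of \<open>A(G;p)\<^sub>(\<^sub>p\<^sub>)\<close> occur in
  \<open>A(\<F>)\<^sub>(\<^sub>p\<^sub>)\<close> (\<open>restrict_to_AF\<close>). Conversely, induction \<open>[S/P] \<mapsto> [G/P]\<close> multiplies stable
  functions by \<open>u\<close> (\<open>induce_from_AF\<close>). This is the count
  \<open>|[Q]| \<Phi>\<^sub>Q(G/P) = \<Phi>\<^sub>Q(G/S) \<Sum> \<Phi>\<^sub>Q\<^sub>'(S/P)\<close>, summed over the \<open>Q'\<close> in the fusion class \<open>[Q]\<close>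
  (\<open>marks_cosets_average\<close>). So \<open>u A(\<F>)\<^sub>(\<^sub>p\<^sub>) \<subseteq> A(G;p)\<^sub>(\<^sub>p\<^sub>) \<subseteq> A(\<F>)\<^sub>(\<^sub>p\<^sub>)\<close>, and it remains to invert
  \<open>u\<close> in \<open>A(\<F>)\<^sub>(\<^sub>p\<^sub>)\<close>. The values of \<open>u\<close> are prime to \<open>p\<close>, since the index of \<open>S\<close> is and a
  \<open>p\<close>-group fixes as many points as there are, modulo \<open>p\<close>. The product of the \<open>t - u\<close> over the values \<open>t\<close> of
  \<open>u\<close> vanishes and has a constant term that is a unit of \<open>\<int>\<^sub>(\<^sub>p\<^sub>)\<close>, which exhibits the inverse
  (\<open>AF_inverse\<close>). Thus the two rings of functions agree, and \<open>A(G;p)\<^sub>(\<^sub>p\<^sub>)\<close> inherits an identity and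
  the inverse of \<open>[G/S]\<close>. The count above also says that the averaged marks in the definition of
  \<open>\<beta>\<^sub>P\<close> are those of \<open>[G/P]\<close> divided by \<open>u\<close>. Hence \<open>\<beta>\<^sub>P\<close> exists and is sent to
  \<open>[G/P] / [G/S]\<close> (\<open>ghost_beta\<close>).\<close>


section \<open>Finite sets with a group action\<close>

locale finite_group = group G for G (structure) +
  assumes finite_carrier: "finite (carrier G)"

lemma (in finite_group) finite_group_subgroup:
  "subgroup H G \<Longrightarrow> finite_group (G\<lparr>carrier := H\<rparr>)"
  using subgroup_imp_group finite_carrier
  by (auto simp: finite_group_def finite_group_axioms_def dest: subgroup.subset finite_subset)

lemma (in finite_group) finite_subgroup: "subgroup H G \<Longrightarrow> finite H"
  using finite_carrier by (auto dest: subgroup.subset finite_subset)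

lemma (in group) subgroup_of_subgroup_iff:
  assumes "subgroup S G"
  shows "subgroup Q (G\<lparr>carrier := S\<rparr>) \<longleftrightarrow> subgroup Q G \<and> Q \<subseteq> S"
  using assms incl_subgroup subgroup_incl
  by (metis subgroup.subset partial_object.simps(1) partial_object.surjective
      partial_object.update_convs(1))

definition gset_restrict :: "('a, 'b) gset \<Rightarrow> 'b set \<Rightarrow> ('a, 'b) gset" where
  "gset_restrict X A = (A, \<lambda>g. restrict (snd X g) A)"

context group
begin

lemma fin_gsetI:
  assumes "finite (fst X)"
    and "\<And>g. g \<in> carrier G \<Longrightarrow> snd X g \<in> extensional (fst X)"
    and closed: "\<And>g x. \<lbrakk>g \<in> carrier G; x \<in> fst X\<rbrakk> \<Longrightarrow> snd X g x \<in> fst X"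
    and one: "\<And>x. x \<in> fst X \<Longrightarrow> snd X \<one> x = x"
    and mult: "\<And>g h x. \<lbrakk>g \<in> carrier G; h \<in> carrier G; x \<in> fst X\<rbrakk>
            \<Longrightarrow> snd X (g \<otimes> h) x = snd X g (snd X h x)"
  shows "fin_gset G X"
proof -
  have "bij_betw (snd X g) (fst X) (fst X)" if "g \<in> carrier G" for g
  proof (rule bij_betwI)
    show "snd X g \<in> fst X \<rightarrow> fst X" "snd X (inv g) \<in> fst X \<rightarrow> fst X"
      using closed that by auto
  next
    fix x assume "x \<in> fst X"
    then show "snd X (inv g) (snd X g x) = x" "snd X g (snd X (inv g) x) = x"
      using that one mult[of "inv g" g x] mult[of g "inv g" x] by auto
  qed
  then have bij: "snd X g \<in> Bij (fst X)" if "g \<in> carrier G" for g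
    using that assms(2) by (auto simp: Bij_def)
  have "snd X \<in> hom G (BijGroup (fst X))"
  proof (rule homI)
    fix g h assume gh: "g \<in> carrier G" "h \<in> carrier G"
    have "snd X (g \<otimes> h) = compose (fst X) (snd X g) (snd X h)"
      using gh assms(2) by (intro extensionalityI[of _ "fst X"]) (auto simp: compose_eq mult)
    then show "snd X (g \<otimes> h) = snd X g \<otimes>\<^bsub>BijGroup (fst X)\<^esub> snd X h"
      using gh bij by (simp add: BijGroup_def)
  qed (simp add: BijGroup_def bij)
  then have "group_hom G (BijGroup (fst X)) (snd X)"
    using group_BijGroup is_group by (auto simp: group_hom_def group_hom_axioms_def)
  then show ?thesis
    using assms(1) by (auto simp: fin_gset_def group_action_def)
qed

lemma fin_gset_extensional:
  "\<lbrakk>fin_gset G X; g \<in> carrier G\<rbrakk> \<Longrightarrow> snd X g \<in> extensional (fst X)"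
  unfolding fin_gset_def by (metis Bij_imp_extensional group_action.bij_prop0)

lemma fin_gset_finite: "fin_gset G X \<Longrightarrow> finite (fst X)"
  by (simp add: fin_gset_def)

lemma fin_gset_closed:
  "\<lbrakk>fin_gset G X; g \<in> carrier G; x \<in> fst X\<rbrakk> \<Longrightarrow> snd X g x \<in> fst X"
  unfolding fin_gset_def by (metis group_action.element_image)

lemma fin_gset_one: "\<lbrakk>fin_gset G X; x \<in> fst X\<rbrakk> \<Longrightarrow> snd X \<one> x = x"
  unfolding fin_gset_def by (metis group_action.id_eq_one restrict_apply')

lemma fin_gset_mult:
  "\<lbrakk>fin_gset G X; g \<in> carrier G; h \<in> carrier G; x \<in> fst X\<rbrakk>
     \<Longrightarrow> snd X (g \<otimes> h) x = snd X g (snd X h x)"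
  unfolding fin_gset_def by (metis group_action.composition_rule)

lemma fin_gset_inv_cancel:
  assumes "fin_gset G X" "g \<in> carrier G" "x \<in> fst X"
  shows "snd X (inv g) (snd X g x) = x" "snd X g (snd X (inv g) x) = x"
  using assms fin_gset_mult[OF assms(1), of "inv g" g x] fin_gset_mult[OF assms(1), of g "inv g" x]
  by (auto simp: fin_gset_one)

lemmas fin_gset_rules = fin_gset_finite fin_gset_extensional fin_gset_closed fin_gset_one fin_gset_mult

lemma fin_gset_empty: "fin_gset G gset_empty"
  by (rule fin_gsetI) (auto simp: gset_empty_def)

lemma fin_gset_point: "fin_gset G gset_point"
  by (rule fin_gsetI) (auto simp: gset_point_def)

lemma fin_gset_sum: "\<lbrakk>fin_gset G X; fin_gset G Y\<rbrakk> \<Longrightarrow> fin_gset G (gset_sum X Y)"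
  by (rule fin_gsetI) (auto simp: gset_sum_def fin_gset_rules)

lemma fin_gset_prod: "\<lbrakk>fin_gset G X; fin_gset G Y\<rbrakk> \<Longrightarrow> fin_gset G (gset_prod X Y)"
  by (rule fin_gsetI) (auto simp: gset_prod_def fin_gset_rules)

lemma fin_gset_restrict:
  assumes "fin_gset G X" "A \<subseteq> fst X" "\<And>g x. \<lbrakk>g \<in> carrier G; x \<in> A\<rbrakk> \<Longrightarrow> snd X g x \<in> A"
  shows "fin_gset G (gset_restrict X A)"
  using assms finite_subset[OF assms(2)] subsetD[OF assms(2)]
  by (intro fin_gsetI) (auto simp: gset_restrict_def fin_gset_rules)

lemma fin_gset_pullback:
  assumes "fin_gset G X" "group H" "f \<in> hom H G"
  shows "fin_gset H (gset_pullback f X)"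
proof -
  interpret H: group H by fact
  interpret group_hom H G f
    using assms by unfold_locales
  show ?thesis
    using assms(1) by (intro H.fin_gsetI) (auto simp: gset_pullback_def fin_gset_rules)
qed

text \<open>The virtual \<open>G\<close>-sets in the Burnside ring have representatives on natural numbers only, whereas
  sets of cosets, sums and products live on other types. The following transport of structure
  shows that such \<open>G\<close>-sets have a nonempty class, too.\<close>

lemma fin_gset_nat_model:
  fixes X :: "('a, 'c) gset"
  assumes "fin_gset G X"
  obtains X' :: "('a, nat) gset" where "fin_gset G X'" "gset_iso G X X'"
proof -
  obtain e :: "'c \<Rightarrow> nat" where e: "inj_on e (fst X)"
    using finite_imp_inj_to_nat_seg[OF fin_gset_finite[OF assms]] by blast
  define d where "d = inv_into (fst X) e"
  define X' where "X' = (e ` fst X, \<lambda>g. \<lambda>n \<in> e ` fst X. e (snd X g (d n)))"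
  have d: "d (e x) = x" if "x \<in> fst X" for x
    using e that by (simp add: d_def)
  have e_eq: "e x = e y \<longleftrightarrow> x = y" if "x \<in> fst X" "y \<in> fst X" for x y
    using inj_on_eq_iff[OF e that] .
  have "fin_gset G X'"
    using fin_gset_closed[OF assms]
    by (intro fin_gsetI) (auto simp: X'_def fin_gset_rules[OF assms] d e_eq)
  moreover have "gset_iso G X X'"
    unfolding gset_iso_def X'_def
    by (rule exI[of _ e]) (use e in \<open>auto simp: d intro: inj_on_imp_bij_betw\<close>)
  ultimately show thesis by (rule that)
qed

end


section \<open>Marks\<close>

text \<open>The value at sets that are not subgroups is fixed to be \<open>0\<close>, so that equality of functions means
  equality of all fixed-point numbers.\<close>

definition marks :: "('a, 'm) monoid_scheme \<Rightarrow> ('a, 'b) gset \<Rightarrow> 'a set \<Rightarrow> rat" where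
  "marks G X Q = (if subgroup Q G then of_nat (card (gset_fixed Q X)) else 0)"

lemma marks_eqI:
  assumes "\<And>Q. subgroup Q G \<Longrightarrow> card (gset_fixed Q X) = card (gset_fixed Q Y)"
  shows "marks G X = marks G Y"
  using assms by (auto simp: marks_def)

lemma gset_fixed_sum: "gset_fixed Q (gset_sum X Y) = gset_fixed Q X <+> gset_fixed Q Y"
  by (force simp: gset_fixed_def gset_sum_def)

lemma gset_fixed_prod: "gset_fixed Q (gset_prod X Y) = gset_fixed Q X \<times> gset_fixed Q Y"
  by (auto simp: gset_fixed_def gset_prod_def)

lemma finite_gset_fixed: "finite (fst X) \<Longrightarrow> finite (gset_fixed Q X)"
  by (simp add: gset_fixed_def)

lemma gset_fixed_pullback: "gset_fixed Q (gset_pullback f X) = gset_fixed (f ` Q) X"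
  by (auto simp: gset_fixed_def gset_pullback_def)

lemma marks_empty: "marks G gset_empty = 0"
  by (auto simp: marks_def gset_fixed_def gset_empty_def)

lemma marks_point: "marks G gset_point = (\<lambda>Q. if subgroup Q G then 1 else 0)"
  by (auto simp: marks_def gset_fixed_def gset_point_def)

context group
begin

lemma marks_sum:
  "\<lbrakk>fin_gset G X; fin_gset G Y\<rbrakk> \<Longrightarrow> marks G (gset_sum X Y) = marks G X + marks G Y"
  by (auto simp: fun_eq_iff marks_def gset_fixed_sum card_Plus fin_gset_finite finite_gset_fixed)

lemma marks_prod: "marks G (gset_prod X Y) = marks G X * marks G Y"
  by (auto simp: fun_eq_iff marks_def gset_fixed_prod card_cartesian_product)

lemma gset_iso_imp_marks_eq:
  assumes "fin_gset G X" "gset_iso G X Y"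
  shows "marks G X = marks G Y"
proof (rule marks_eqI)
  fix Q assume Q: "subgroup Q G"
  obtain f where f: "bij_betw f (fst X) (fst Y)"
    and equiv: "\<And>g x. \<lbrakk>g \<in> carrier G; x \<in> fst X\<rbrakk> \<Longrightarrow> f (snd X g x) = snd Y g (f x)"
    using assms(2) unfolding gset_iso_def by blast
  have "bij_betw f (gset_fixed Q X) (gset_fixed Q Y)"
    unfolding bij_betw_def
  proof
    show "inj_on f (gset_fixed Q X)"
      using f by (auto simp: bij_betw_def gset_fixed_def inj_on_def)
    show "f ` gset_fixed Q X = gset_fixed Q Y"
    proof (intro equalityI subsetI)
      fix y assume "y \<in> f ` gset_fixed Q X"
      then show "y \<in> gset_fixed Q Y"
        using f Q equiv by (auto simp: gset_fixed_def bij_betw_def)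
          (metis subgroup.mem_carrier)
    next
      fix y assume y: "y \<in> gset_fixed Q Y"
      then obtain x where x: "x \<in> fst X" "y = f x"
        using f by (auto simp: gset_fixed_def bij_betw_def)
      have "snd X q x = x" if "q \<in> Q" for q
      proof -
        have q: "q \<in> carrier G" using Q that by (rule subgroup.mem_carrier)
        have "f (snd X q x) = f x" using x y that q by (simp add: equiv gset_fixed_def)
        moreover have "snd X q x \<in> fst X" using assms(1) q x by (simp add: fin_gset_closed)
        ultimately show ?thesis
          using f x by (auto simp: bij_betw_def inj_on_def)
      qed
      then show "y \<in> f ` gset_fixed Q X" using x by (auto simp: gset_fixed_def)
    qed
  qed
  then show "card (gset_fixed Q X) = card (gset_fixed Q Y)"
    by (rule bij_betw_same_card)
qed

lemma marks_restrict_split: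
  assumes "fin_gset G X" "A \<subseteq> fst X"
  shows "marks G X = marks G (gset_restrict X A) + marks G (gset_restrict X (fst X - A))"
proof
  fix Q
  have "gset_fixed Q X
      = gset_fixed Q (gset_restrict X A) \<union> gset_fixed Q (gset_restrict X (fst X - A))"
    using assms(2) by (auto simp: gset_fixed_def gset_restrict_def)
  moreover have "gset_fixed Q (gset_restrict X A) \<inter> gset_fixed Q (gset_restrict X (fst X - A)) = {}"
    by (auto simp: gset_fixed_def gset_restrict_def)
  moreover have "finite (gset_fixed Q (gset_restrict X A))"
       "finite (gset_fixed Q (gset_restrict X (fst X - A)))"
    using fin_gset_finite[OF assms(1)] finite_subset[OF assms(2)]
    by (auto intro!: finite_gset_fixed simp: gset_restrict_def)
  ultimately show "marks G X Q
      = (marks G (gset_restrict X A) + marks G (gset_restrict X (fst X - A))) Q"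
    by (simp add: marks_def card_Un_disjoint)
qed

lemma stabilizer_subgroup: "\<lbrakk>fin_gset G X; x \<in> fst X\<rbrakk> \<Longrightarrow> subgroup (stabilizer G (snd X) x) G"
  unfolding fin_gset_def by (auto intro: group_action.stabilizer_subgroup)

lemma gset_fixed_iff_stabilizer:
  "subgroup Q G \<Longrightarrow> x \<in> gset_fixed Q X \<longleftrightarrow> x \<in> fst X \<and> Q \<subseteq> stabilizer G (snd X) x"
  by (auto simp: gset_fixed_def stabilizer_def dest: subgroup.mem_carrier)

lemma act_eq_iff:
  assumes "fin_gset G X" "x \<in> fst X" "g \<in> carrier G" "h \<in> carrier G"
  shows "snd X g x = snd X h x \<longleftrightarrow> inv g \<otimes> h \<in> stabilizer G (snd X) x"
proof -
  have "snd X (inv g \<otimes> h) x = snd X (inv g) (snd X h x)"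
    using assms by (simp add: fin_gset_mult)
  then show ?thesis
    using assms fin_gset_inv_cancel(1)[OF assms(1,3,2)] fin_gset_closed[OF assms(1)]
      fin_gset_inv_cancel(2)[OF assms(1,3), of "snd X h x"]
    by (fastforce simp: stabilizer_def)
qed

lemma orbit_subset: "\<lbrakk>fin_gset G X; x \<in> fst X\<rbrakk> \<Longrightarrow> orbit G (snd X) x \<subseteq> fst X"
  by (auto simp: orbit_def fin_gset_closed)

lemma orbit_self: "\<lbrakk>fin_gset G X; x \<in> fst X\<rbrakk> \<Longrightarrow> x \<in> orbit G (snd X) x"
  unfolding orbit_def using fin_gset_one[of X x] one_closed by (metis (mono_tags, lifting) mem_Collect_eq)

lemma orbit_invariant:
  assumes "fin_gset G X" "x \<in> fst X" "g \<in> carrier G" "y \<in> fst X"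
  shows "snd X g y \<in> orbit G (snd X) x \<longleftrightarrow> y \<in> orbit G (snd X) x"
proof
  assume "y \<in> orbit G (snd X) x"
  then show "snd X g y \<in> orbit G (snd X) x"
    using assms unfolding orbit_def by (auto simp flip: fin_gset_mult)
next
  assume "snd X g y \<in> orbit G (snd X) x"
  then obtain h where "h \<in> carrier G" "snd X g y = snd X h x"
    by (auto simp: orbit_def)
  then have "y = snd X (inv g \<otimes> h) x"
    using assms fin_gset_inv_cancel(1)[OF assms(1,3,4)] by (simp add: fin_gset_mult)
  then show "y \<in> orbit G (snd X) x"
    using \<open>h \<in> carrier G\<close> assms unfolding orbit_def by blast
qed

lemma fin_gset_orbit:
  "\<lbrakk>fin_gset G X; x \<in> fst X\<rbrakk> \<Longrightarrow> fin_gset G (gset_restrict X (orbit G (snd X) x))"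
  using orbit_subset[of X x] by (intro fin_gset_restrict) (auto simp: orbit_invariant subset_iff)

lemma fin_gset_remove_orbit:
  "\<lbrakk>fin_gset G X; x \<in> fst X\<rbrakk> \<Longrightarrow> fin_gset G (gset_restrict X (fst X - orbit G (snd X) x))"
  by (rule fin_gset_restrict) (auto simp: orbit_invariant fin_gset_closed)

text \<open>A transitive \<open>G\<close>-set is determined by the stabilizer of one point: \<open>g x \<mapsto> g y\<close> is
  well defined and injective because both sides identify the same group elements.\<close>

lemma orbit_iso:
  assumes X: "fin_gset G X" "x \<in> fst X" and Y: "fin_gset G Y" "y \<in> fst Y"
    and stab: "stabilizer G (snd X) x = stabilizer G (snd Y) y"
  shows "gset_iso G (gset_restrict X (orbit G (snd X) x)) (gset_restrict Y (orbit G (snd Y) y))"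
proof -
  define f where "f z = snd Y (SOME g. g \<in> carrier G \<and> snd X g x = z) y" for z
  have f: "f (snd X g x) = snd Y g y" if "g \<in> carrier G" for g
  proof -
    have "\<exists>h. h \<in> carrier G \<and> snd X h x = snd X g x" using that by blast
    then have "(SOME h. h \<in> carrier G \<and> snd X h x = snd X g x) \<in> carrier G \<and>
         snd X (SOME h. h \<in> carrier G \<and> snd X h x = snd X g x) x = snd X g x"
      by (rule someI_ex)
    then show ?thesis
      unfolding f_def using act_eq_iff[OF X] act_eq_iff[OF Y] stab that by blast
  qed
  have "inj_on f (orbit G (snd X) x)"
    using act_eq_iff[OF X] act_eq_iff[OF Y] stab f
    by (auto simp: inj_on_def orbit_def)
  moreover have "f ` orbit G (snd X) x = orbit G (snd Y) y"
    using f by (force simp: orbit_def)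
  moreover have "f (snd X g z) = snd Y g (f z)"
    if g: "g \<in> carrier G" and z: "z \<in> orbit G (snd X) x" for g z
  proof -
    obtain h where h: "h \<in> carrier G" "z = snd X h x" using z by (auto simp: orbit_def)
    then have "snd X g z = snd X (g \<otimes> h) x"
      using g X by (simp add: fin_gset_mult)
    then show ?thesis
      using h g Y by (simp add: f fin_gset_mult)
  qed
  ultimately show ?thesis
    unfolding gset_iso_def gset_restrict_def
    by (intro exI[of _ f]) (auto simp: bij_betw_def)
qed

lemma gset_iso_glue:
  assumes "A \<subseteq> fst X" "C \<subseteq> fst Y"
    and inv: "\<And>g x. \<lbrakk>g \<in> carrier G; x \<in> fst X\<rbrakk> \<Longrightarrow> snd X g x \<in> A \<longleftrightarrow> x \<in> A"
    and "gset_iso G (gset_restrict X A) (gset_restrict Y C)"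
    and "gset_iso G (gset_restrict X (fst X - A)) (gset_restrict Y (fst Y - C))"
  shows "gset_iso G X Y"
proof -
  have unfold: "\<exists>f. bij_betw f B D \<and> (\<forall>g\<in>carrier G. \<forall>x\<in>B. f (snd X g x) = snd Y g (f x))"
    if iso: "gset_iso G (gset_restrict X B) (gset_restrict Y D)" for B D
  proof -
    obtain f where "bij_betw f B D"
        "\<And>g x. \<lbrakk>g \<in> carrier G; x \<in> B\<rbrakk> \<Longrightarrow> f (snd X g x) = restrict (snd Y g) D (f x)"
      using iso by (auto simp: gset_iso_def gset_restrict_def)
    then show ?thesis by (intro exI[of _ f]) (auto dest: bij_betwE)
  qed
  obtain f where f: "bij_betw f A C"
      "\<And>g x. \<lbrakk>g \<in> carrier G; x \<in> A\<rbrakk> \<Longrightarrow> f (snd X g x) = snd Y g (f x)"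
    using unfold[OF assms(4)] by blast
  obtain h where h: "bij_betw h (fst X - A) (fst Y - C)"
      "\<And>g x. \<lbrakk>g \<in> carrier G; x \<in> fst X - A\<rbrakk> \<Longrightarrow> h (snd X g x) = snd Y g (h x)"
    using unfold[OF assms(5)] by blast
  have "bij_betw (\<lambda>x. if x \<in> A then f x else h x) (A \<union> (fst X - A)) (C \<union> (fst Y - C))"
    using f(1) h(1) by (rule bij_betw_disjoint_Un) auto
  moreover have "A \<union> (fst X - A) = fst X" "C \<union> (fst Y - C) = fst Y"
    using assms(1,2) by auto
  ultimately show ?thesis
    unfolding gset_iso_def using inv f(2) h(2)
    by (intro exI[of _ "\<lambda>x. if x \<in> A then f x else h x"]) auto
qed

text \<open>The cardinality is one of the marks. This starts the induction in Burnside's theorem.\<close>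

lemma marks_trivial_subgroup: "fin_gset G X \<Longrightarrow> marks G X {\<one>} = of_nat (card (fst X))"
  using triv_subgroup by (auto simp: marks_def gset_fixed_def fin_gset_one intro: arg_cong[of _ _ card])

end

text \<open>Burnside's theorem, by induction on the number of points. A point \<open>x\<close> of \<open>X\<close> with the largest
  stabilizer \<open>H\<close> shows that \<open>H\<close> has a fixed point \<open>y\<close> in \<open>Y\<close>. The stabilizer of \<open>y\<close> contains
  \<open>H\<close> and has a fixed point in \<open>X\<close> in turn, so by maximality it is equal to \<open>H\<close>. Then the orbits of \<open>x\<close> and
  \<open>y\<close> are isomorphic, and removing them leaves sets with equal marks.\<close>

theorem (in finite_group) marks_eq_imp_gset_iso:
  assumes "fin_gset G X" "fin_gset G Y" "marks G X = marks G Y"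
  shows "gset_iso G X Y"
  using assms
proof (induction "card (fst X)" arbitrary: X Y rule: less_induct)
  case less
  note X = less.prems(1) and Y = less.prems(2) and eq = less.prems(3)
  show ?case
  proof (cases "fst X = {}")
    case True
    then have "fst Y = {}"
      using eq marks_trivial_subgroup[OF X] marks_trivial_subgroup[OF Y] fin_gset_finite[OF Y]
      by auto
    with True show ?thesis by (simp add: gset_iso_def bij_betw_def)
  next
    case False
    let ?st = "\<lambda>X x. stabilizer G (snd X) x"
    obtain x where x: "x \<in> fst X" and x_max: "card (?st X x) = (MAX z\<in>fst X. card (?st X z))"
      using obtains_MAX[OF fin_gset_finite[OF X] False] by metis
    have max: "card (?st X z) \<le> card (?st X x)" if "z \<in> fst X" for z
      unfolding x_max using that fin_gset_finite[OF X] by simp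
    have sub: "subgroup (?st X x) G" using X x by (rule stabilizer_subgroup)
    have nonempty: "gset_fixed Q Y \<noteq> {} \<longleftrightarrow> gset_fixed Q X \<noteq> {}" if "subgroup Q G" for Q
    proof -
      have "card (gset_fixed Q X) = card (gset_fixed Q Y)"
        using fun_cong[OF eq, of Q] that by (simp add: marks_def)
      then show ?thesis
        using X Y by (metis card_0_eq fin_gset_finite finite_gset_fixed)
    qed
    have "x \<in> gset_fixed (?st X x) X" using sub x by (simp add: gset_fixed_iff_stabilizer)
    then have "gset_fixed (?st X x) Y \<noteq> {}" using nonempty[OF sub] by blast
    then obtain y where y: "y \<in> fst Y" "?st X x \<subseteq> ?st Y y"
      using gset_fixed_iff_stabilizer[OF sub, of _ Y] by blast
    have suby: "subgroup (?st Y y) G" using Y y(1) by (rule stabilizer_subgroup)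
    have "y \<in> gset_fixed (?st Y y) Y" using suby y by (simp add: gset_fixed_iff_stabilizer)
    then have "gset_fixed (?st Y y) X \<noteq> {}" using nonempty[OF suby] by blast
    then obtain z where z: "z \<in> fst X" "?st Y y \<subseteq> ?st X z"
      using gset_fixed_iff_stabilizer[OF suby, of _ X] by blast
    (* ?st Y y fixes the point z of X, so it is no larger than the largest stabilizer in X *)
    have "card (?st Y y) \<le> card (?st X x)"
      using card_mono[OF finite_subgroup[OF stabilizer_subgroup[OF X z(1)]] z(2)] max[OF z(1)] by simp
    then have st: "?st X x = ?st Y y"
      using card_seteq[OF finite_subgroup[OF suby] y(2)] by blast
    define A where "A = orbit G (snd X) x"
    define C where "C = orbit G (snd Y) y"
    have iso: "gset_iso G (gset_restrict X A) (gset_restrict Y C)"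
      unfolding A_def C_def by (rule orbit_iso) fact+
    have "marks G (gset_restrict X (fst X - A)) = marks G (gset_restrict Y (fst Y - C))"
      using marks_restrict_split[OF X orbit_subset[OF X x]]
        marks_restrict_split[OF Y orbit_subset[OF Y y(1)]] eq
        gset_iso_imp_marks_eq[OF fin_gset_orbit[OF X x] iso[unfolded A_def]]
      by (simp add: A_def C_def)
    moreover have "card (fst (gset_restrict X (fst X - A))) < card (fst X)"
      using orbit_self[OF X x] x fin_gset_finite[OF X]
      by (auto simp: gset_restrict_def A_def intro!: psubset_card_mono)
    ultimately have "gset_iso G (gset_restrict X (fst X - A)) (gset_restrict Y (fst Y - C))"
      using fin_gset_remove_orbit[OF X x] fin_gset_remove_orbit[OF Y y(1)]
      by (intro less.hyps) (simp_all add: A_def C_def)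
    then show ?thesis
      using orbit_subset[OF X x] orbit_subset[OF Y y(1)] orbit_invariant[OF X x] iso
      by - (rule gset_iso_glue[of A X C Y];  simp add: A_def C_def)
  qed
qed


section \<open>Transitive sets and orbit decompositions\<close>

context group
begin

lemma lcoset_eq_iff:
  assumes "subgroup H G" "a \<in> carrier G" "b \<in> carrier G"
  shows "a <# H = b <# H \<longleftrightarrow> inv b \<otimes> a \<in> H"
proof
  assume "a <# H = b <# H"
  then have "a \<in> b <# H" using lcos_self[OF assms(2,1)] by simp
  then show "inv b \<otimes> a \<in> H"
    by (rule subgroup.lcos_module_imp[OF assms(1) is_group assms(3)])
next
  assume h: "inv b \<otimes> a \<in> H"
  have "a = b \<otimes> (inv b \<otimes> a)" using assms by (simp flip: m_assoc)
  then have "a \<in> b <# H" using h unfolding l_coset_def by blast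
  then show "a <# H = b <# H"
    using l_repr_independence[OF _ assms(3,1)] by simp
qed

lemma lcoset_closed: "g \<in> carrier G \<Longrightarrow> g <# H \<in> lcosets H"
  by (auto simp: LCOSETS_def)

lemma lcosetsE:
  assumes "C \<in> lcosets H" obtains g where "g \<in> carrier G" "C = g <# H"
  using assms by (auto simp: LCOSETS_def)

lemma lcos_one: "subgroup H G \<Longrightarrow> \<one> <# H = H"
  by (simp add: lcos_mult_one subgroup.subset)

lemma coset_action: 
  assumes "subgroup H G" "g \<in> carrier G" "k \<in> carrier G"
  shows "snd (gset_cosets G H) g (k <# H) = (g \<otimes> k) <# H"
  using assms lcos_m_assoc[of H g k] by (simp add: gset_cosets_def lcoset_closed subgroup.subset)

lemma fst_gset_cosets: "fst (gset_cosets G H) = lcosets H"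
  by (simp add: gset_cosets_def)

lemma stabilizer_gset_cosets:
  assumes "subgroup H G" shows "stabilizer G (snd (gset_cosets G H)) H = H"
  using coset_action[OF assms, of _ \<one>] lcoset_eq_iff[OF assms, of _ \<one>]
    subgroup.subset[OF assms]
  by (auto simp: stabilizer_def lcos_one[OF assms] subset_iff)

lemma orbit_gset_cosets:
  assumes "subgroup H G" shows "orbit G (snd (gset_cosets G H)) H = lcosets H"
  using coset_action[OF assms, of _ \<one>] lcos_one[OF assms]
  by (auto simp: orbit_def LCOSETS_def)

text \<open>The convention is \<open>g\<^sup>-\<^sup>1 Q g \<subseteq> P\<close>, since this is what it means for \<open>Q\<close> to fix the left coset \<open>g P\<close>.\<close>

definition transporter :: "'a set \<Rightarrow> 'a set \<Rightarrow> 'a set" where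
  "transporter Q P = {g \<in> carrier G. \<forall>q\<in>Q. inv g \<otimes> q \<otimes> g \<in> P}"

lemma coset_fixed_iff:
  assumes "subgroup P G" "subgroup Q G" "g \<in> carrier G"
  shows "g <# P \<in> gset_fixed Q (gset_cosets G P) \<longleftrightarrow> g \<in> transporter Q P"
proof -
  have "snd (gset_cosets G P) q (g <# P) = g <# P \<longleftrightarrow> inv g \<otimes> q \<otimes> g \<in> P" if "q \<in> Q" for q
  proof -
    have "q \<in> carrier G" using assms(2) that by (rule subgroup.mem_carrier)
    then show ?thesis
      using assms by (simp add: coset_action lcoset_eq_iff m_assoc)
  qed
  then show ?thesis
    using assms by (auto simp: gset_fixed_def transporter_def fst_gset_cosets lcoset_closed)
qed

end

context finite_group
begin

lemma fin_gset_cosets: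
  assumes "subgroup H G" shows "fin_gset G (gset_cosets G H)"
proof (rule fin_gsetI)
  show "finite (fst (gset_cosets G H))"
    by (simp add: fst_gset_cosets LCOSETS_def finite_carrier)
  show "\<And>g. snd (gset_cosets G H) g \<in> extensional (fst (gset_cosets G H))"
    by (simp add: gset_cosets_def)
qed (auto simp: fst_gset_cosets coset_action assms lcoset_closed m_assoc elim!: lcosetsE)

text \<open>The orbit of \<open>x\<close> and the cosets of its stabilizer \<open>H\<close> are both orbits of a point
  with stabilizer \<open>H\<close>, the point of the latter being the coset \<open>H\<close> itself.\<close>

lemma marks_orbit:
  assumes "fin_gset G X" "x \<in> fst X"
  shows "marks G (gset_restrict X (orbit G (snd X) x))
    = marks G (gset_cosets G (stabilizer G (snd X) x))"
proof -
  let ?H = "stabilizer G (snd X) x"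
  have H: "subgroup ?H G" using assms by (rule stabilizer_subgroup)
  have "?H \<in> fst (gset_cosets G ?H)"
    using H lcoset_closed[OF one_closed] by (metis fst_gset_cosets lcos_one)
  then have "gset_iso G (gset_restrict X (orbit G (snd X) x))
      (gset_restrict (gset_cosets G ?H) (orbit G (snd (gset_cosets G ?H)) ?H))"
    using assms H by (intro orbit_iso) (simp_all add: fin_gset_cosets stabilizer_gset_cosets)
  then have "marks G (gset_restrict X (orbit G (snd X) x))
      = marks G (gset_restrict (gset_cosets G ?H) (lcosets ?H))"
    using assms H gset_iso_imp_marks_eq[OF fin_gset_orbit] by (simp add: orbit_gset_cosets)
  also have "gset_restrict (gset_cosets G ?H) (lcosets ?H) = gset_cosets G ?H"
    by (simp add: gset_restrict_def gset_cosets_def)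
  finally show ?thesis .
qed

text \<open>Decomposition into orbits, in the form of an induction rule for additive properties of marks.
  The step only involves stabilizers of points of the given set. This makes the rule usable for
  \<open>G\<close>-sets whose isotropy groups are restricted, as in \<open>A(G;p)\<close>.\<close>

lemma marks_orbit_induct:
  assumes "fin_gset G X" and "P 0"
    and "\<And>f x. \<lbrakk>x \<in> fst X; P f\<rbrakk> \<Longrightarrow> P (marks G (gset_cosets G (stabilizer G (snd X) x)) + f)"
  shows "P (marks G X)"
  using assms(1,3)
proof (induction "card (fst X)" arbitrary: X rule: less_induct)
  case less
  note X = less.prems(1) and step = less.prems(2)
  show ?case
  proof (cases "fst X = {}")
    case True
    then have "marks G X = 0" by (auto simp: marks_def gset_fixed_def)
    with assms(2) show ?thesis by simp
  next
    case False
    then obtain x where x: "x \<in> fst X" by blast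
    let ?A = "orbit G (snd X) x"
    let ?Y = "gset_restrict X (fst X - ?A)"
    have "stabilizer G (snd ?Y) y = stabilizer G (snd X) y" if "y \<in> fst ?Y" for y
      using that by (auto simp: stabilizer_def gset_restrict_def)
    moreover have "card (fst ?Y) < card (fst X)"
      using orbit_self[OF X x] x fin_gset_finite[OF X]
      by (auto simp: gset_restrict_def intro!: psubset_card_mono)
    moreover have "fst ?Y \<subseteq> fst X" by (auto simp: gset_restrict_def)
    ultimately have "P (marks G ?Y)"
      using step fin_gset_remove_orbit[OF X x] by (intro less.hyps) auto
    then show ?thesis
      using marks_restrict_split[OF X orbit_subset[OF X x]] marks_orbit[OF X x] step[OF x] by simp
  qed
qed

text \<open>The transporter is the disjoint union of the cosets that are fixed by \<open>Q\<close>.\<close>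

lemma card_fixed_cosets:
  assumes "subgroup P G" "subgroup Q G"
  shows "card (gset_fixed Q (gset_cosets G P)) * card P = card (transporter Q P)"
proof -
  let ?F = "gset_fixed Q (gset_cosets G P)"
  have sub: "?F \<subseteq> lcosets P" by (auto simp: gset_fixed_def fst_gset_cosets)
  have union: "\<Union>?F = transporter Q P"
  proof (intro equalityI subsetI)
    fix x assume "x \<in> \<Union>?F"
    then obtain C where C: "C \<in> ?F" "x \<in> C" by blast
    then obtain g where g: "g \<in> carrier G" "C = g <# P" using sub by (auto elim!: lcosetsE)
    then have x: "x \<in> carrier G" using C assms by (meson subgroup.subset l_coset_subset_G subsetD)
    have "C = x <# P" using g C assms l_repr_independence[of x g P] by simp
    then show "x \<in> transporter Q P" using C x assms coset_fixed_iff by blast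
  next
    fix x assume x: "x \<in> transporter Q P"
    then have "x \<in> carrier G" by (simp add: transporter_def)
    then show "x \<in> \<Union>?F" using x assms coset_fixed_iff lcos_self by blast
  qed
  have "card P * card ?F = card (\<Union>?F)"
  proof (rule card_partition)
    show "finite ?F" using fin_gset_cosets[OF assms(1)] by (simp add: fin_gset_finite finite_gset_fixed)
    show "finite (\<Union>?F)" using finite_carrier by (simp add: union transporter_def)
    show "card C = card P" if "C \<in> ?F" for C
      using that sub subgroup.subset[OF assms(1)] finite_carrier l_card_cosets_equal[of C P] by auto
    show "C \<inter> D = {}" if "C \<in> ?F" "D \<in> ?F" "C \<noteq> D" for C D
      using that sub lcos_disjoint[OF assms(1)] by blast
  qed
  then show ?thesis by (simp add: union mult.commute)
qed

lemma marks_cosets: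
  assumes "subgroup P G" "subgroup Q G"
  shows "marks G (gset_cosets G P) Q = of_nat (card (transporter Q P)) / of_nat (card P)"
proof -
  have "card P \<noteq> 0"
    using finite_subgroup[OF assms(1)] subgroup.one_closed[OF assms(1)] by auto
  then show ?thesis
    using assms(2) by (simp add: marks_def field_simps flip: card_fixed_cosets[OF assms] of_nat_mult)
qed

end


section \<open>Conjugation of subgroups and fusion\<close>

context group
begin

definition conjugate :: "'a \<Rightarrow> 'a set \<Rightarrow> 'a set" where
  "conjugate g Q = (\<lambda>x. g \<otimes> x \<otimes> inv g) ` Q"

lemma conjugate_one: "Q \<subseteq> carrier G \<Longrightarrow> conjugate \<one> Q = Q"
  by (force simp: conjugate_def)

lemma conjugate_mult:
  assumes "g \<in> carrier G" "h \<in> carrier G" "Q \<subseteq> carrier G"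
  shows "conjugate g (conjugate h Q) = conjugate (g \<otimes> h) Q"
  unfolding conjugate_def image_image
  by (rule image_cong) (use assms in \<open>auto simp: m_assoc inv_mult_group subset_iff\<close>)

lemma conjugate_inv_cancel:
  assumes "g \<in> carrier G" "Q \<subseteq> carrier G"
  shows "conjugate (inv g) (conjugate g Q) = Q" "conjugate g (conjugate (inv g) Q) = Q"
  using assms by (simp_all add: conjugate_mult conjugate_one)

lemma conjugation_hom: "g \<in> carrier G \<Longrightarrow> (\<lambda>x. g \<otimes> x \<otimes> inv g) \<in> hom G G"
  by (rule homI) (auto simp: m_assoc inv_solve_left)

lemma subgroup_conjugate:
  assumes "g \<in> carrier G" "subgroup Q G"
  shows "subgroup (conjugate g Q) G"
proof -
  interpret group_hom G G "\<lambda>x. g \<otimes> x \<otimes> inv g"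
    using conjugation_hom[OF assms(1)] by unfold_locales
  show ?thesis unfolding conjugate_def using assms(2) by (rule subgroup_img_is_subgroup)
qed

lemma conjugate_mono: "A \<subseteq> B \<Longrightarrow> conjugate g A \<subseteq> conjugate g B"
  by (auto simp: conjugate_def)

lemma conjugate_self: "\<lbrakk>subgroup S G; s \<in> S\<rbrakk> \<Longrightarrow> conjugate s S \<subseteq> S"
  by (auto simp: conjugate_def subgroup.m_closed subgroup.m_inv_closed)

lemma inj_conjugation: "\<lbrakk>g \<in> carrier G; Q \<subseteq> carrier G\<rbrakk> \<Longrightarrow> inj_on (\<lambda>x. g \<otimes> x \<otimes> inv g) Q"
  by (auto simp: inj_on_def subset_iff)

lemma card_conjugate: "\<lbrakk>g \<in> carrier G; Q \<subseteq> carrier G\<rbrakk> \<Longrightarrow> card (conjugate g Q) = card Q"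
  unfolding conjugate_def by (rule card_image) (rule inj_conjugation)

lemma transporter_iff:
  "g \<in> transporter Q P \<longleftrightarrow> g \<in> carrier G \<and> conjugate (inv g) Q \<subseteq> P"
  by (auto simp: transporter_def conjugate_def)

text \<open>The element \<open>g\<close> moves the fixed points of \<open>Q\<close> to those of its conjugate, and its inverse moves
  them back.\<close>

lemma gset_fixed_conjugate:
  assumes X: "fin_gset G X" and g: "g \<in> carrier G" and Q: "subgroup Q G"
  shows "card (gset_fixed (conjugate g Q) X) = card (gset_fixed Q X)"
proof -
  have shift: "snd X h x \<in> gset_fixed (conjugate h P) X"
    if h: "h \<in> carrier G" and P: "subgroup P G" and x: "x \<in> gset_fixed P X" for h P x
  proof -
    have "snd X (h \<otimes> q \<otimes> inv h) (snd X h x) = snd X h x" if "q \<in> P" for q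
    proof -
      have q: "q \<in> carrier G" using P that by (rule subgroup.mem_carrier)
      have "snd X (h \<otimes> q \<otimes> inv h) (snd X h x) = snd X (h \<otimes> q \<otimes> inv h \<otimes> h) x"
        using X h q x by (simp add: fin_gset_mult gset_fixed_def)
      also have "h \<otimes> q \<otimes> inv h \<otimes> h = h \<otimes> q" using h q by (simp add: m_assoc)
      also have "snd X (h \<otimes> q) x = snd X h x"
        using X h q x that by (simp add: fin_gset_mult gset_fixed_def)
      finally show ?thesis .
    qed
    then show ?thesis
      using X h x by (auto simp: gset_fixed_def conjugate_def fin_gset_closed)
  qed
  have "bij_betw (snd X g) (gset_fixed Q X) (gset_fixed (conjugate g Q) X)"
  proof (rule bij_betwI)
    show "snd X g \<in> gset_fixed Q X \<rightarrow> gset_fixed (conjugate g Q) X"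
      using shift[OF g Q] by blast
    show "snd X (inv g) \<in> gset_fixed (conjugate g Q) X \<rightarrow> gset_fixed Q X"
      using shift[OF inv_closed[OF g] subgroup_conjugate[OF g Q]]
        conjugate_inv_cancel(1)[OF g subgroup.subset[OF Q]] by auto
  qed (use X g in \<open>auto simp: fin_gset_inv_cancel gset_fixed_def\<close>)
  then show ?thesis by (rule bij_betw_same_card[symmetric])
qed

lemma fusion_mor_iff:
  "\<phi> \<in> fusion_mor G P Q \<longleftrightarrow>
     (\<exists>g\<in>carrier G. conjugate g P \<subseteq> Q \<and> \<phi> = (\<lambda>x\<in>P. g \<otimes> x \<otimes> inv g))"
  by (auto simp: fusion_mor_def conjugate_def)

text \<open>A morphism of the fusion system that has an inverse is surjective, so that the conjugation which
  induces it maps \<open>Q\<close> onto \<open>Q'\<close>.\<close>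

lemma fusion_conj_iff:
  assumes Q: "subgroup Q G"
  shows "fusion_conj G Q Q' \<longleftrightarrow> (\<exists>g\<in>carrier G. Q' = conjugate g Q)"
proof
  assume "fusion_conj G Q Q'"
  then obtain \<phi> \<psi> where *: "\<phi> \<in> fusion_mor G Q Q'" "\<psi> \<in> fusion_mor G Q' Q"
      "compose Q' \<phi> \<psi> = (\<lambda>x\<in>Q'. x)"
    by (auto simp: fusion_conj_def)
  obtain g where g: "g \<in> carrier G" "conjugate g Q \<subseteq> Q'" "\<phi> = (\<lambda>x\<in>Q. g \<otimes> x \<otimes> inv g)"
    using *(1) fusion_mor_iff by blast
  obtain h where h: "conjugate h Q' \<subseteq> Q" "\<psi> = (\<lambda>x\<in>Q'. h \<otimes> x \<otimes> inv h)"
    using *(2) fusion_mor_iff by blast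
  have "y \<in> conjugate g Q" if "y \<in> Q'" for y
  proof -
    have "\<psi> y \<in> Q" using h that by (auto simp: conjugate_def)
    moreover have "\<phi> (\<psi> y) = y" using fun_cong[OF *(3), of y] that by (simp add: compose_def)
    ultimately show ?thesis using g(3) by (force simp: conjugate_def)
  qed
  then show "\<exists>g\<in>carrier G. Q' = conjugate g Q" using g by blast
next
  assume "\<exists>g\<in>carrier G. Q' = conjugate g Q"
  then obtain g where g: "g \<in> carrier G" and Q': "Q' = conjugate g Q" by blast
  have sub: "Q \<subseteq> carrier G" using Q by (rule subgroup.subset)
  let ?\<phi> = "\<lambda>x\<in>Q. g \<otimes> x \<otimes> inv g" and ?\<psi> = "\<lambda>x\<in>Q'. inv g \<otimes> x \<otimes> inv (inv g)"
  have "?\<phi> \<in> fusion_mor G Q Q'" unfolding fusion_mor_iff using g Q' by blast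
  moreover have "?\<psi> \<in> fusion_mor G Q' Q"
    unfolding fusion_mor_iff using g Q' conjugate_inv_cancel(1)[OF g sub]
    by (intro bexI[of _ "inv g"]) auto
  moreover have cancel: "inv g \<otimes> (g \<otimes> x \<otimes> inv g) \<otimes> g = x" if "x \<in> Q" for x
    using that sub g by (auto simp: m_assoc subset_iff simp flip: m_assoc[of "inv g" g])
  then have "compose Q ?\<psi> ?\<phi> = (\<lambda>x\<in>Q. x)"
    using g by (auto simp: compose_def fun_eq_iff Q' conjugate_def)
  moreover have "compose Q' ?\<phi> ?\<psi> = (\<lambda>x\<in>Q'. x)"
    using g cancel by (auto simp: compose_def fun_eq_iff Q' conjugate_def)
  ultimately show "fusion_conj G Q Q'" unfolding fusion_conj_def by blast
qed

lemma fusion_class_iff: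
  "subgroup Q G \<Longrightarrow>
     Q' \<in> fusion_class G S Q \<longleftrightarrow> Q' \<subseteq> S \<and> (\<exists>g\<in>carrier G. Q' = conjugate g Q)"
  by (auto simp: fusion_class_def fusion_conj_iff subgroup_conjugate)

lemma fusion_class_self: "\<lbrakk>subgroup Q G; Q \<subseteq> S\<rbrakk> \<Longrightarrow> Q \<in> fusion_class G S Q"
  using conjugate_one[OF subgroup.subset, of Q] by (auto simp: fusion_class_iff intro!: bexI[of _ \<one>])

end


section \<open>Counting fixed points\<close>

context finite_group
begin

lemma fin_gset_subgroup:
  assumes "fin_gset G X" "subgroup H G"
  shows "fin_gset (G\<lparr>carrier := H\<rparr>) X"
proof -
  have "(\<lambda>x. x) \<in> hom (G\<lparr>carrier := H\<rparr>) G"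
    using subgroup.mem_carrier[OF assms(2)] by (auto intro: homI)
  then have "fin_gset (G\<lparr>carrier := H\<rparr>) (gset_pullback (\<lambda>x. x) X)"
    using assms subgroup_imp_group by (intro fin_gset_pullback)
  then show ?thesis by (simp add: gset_pullback_def)
qed

text \<open>The elements that conjugate \<open>Q\<close> to a given subgroup form a coset of the normalizer of \<open>Q\<close>.\<close>

lemma card_same_conjugate: 
  assumes Q: "subgroup Q G" and g: "g \<in> carrier G"
  shows "card {k \<in> carrier G. conjugate (inv k) Q = conjugate (inv g) Q}
    = card {k \<in> carrier G. conjugate (inv k) Q = Q}"
proof -
  note sub = subgroup.subset[OF Q]
  have "bij_betw (\<lambda>k. k \<otimes> g) {k \<in> carrier G. conjugate (inv k) Q = Q}
     {k \<in> carrier G. conjugate (inv k) Q = conjugate (inv g) Q}"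
  proof (rule bij_betwI[where g = "\<lambda>k. k \<otimes> inv g"])
    show "(\<lambda>k. k \<otimes> g) \<in> {k \<in> carrier G. conjugate (inv k) Q = Q}
        \<rightarrow> {k \<in> carrier G. conjugate (inv k) Q = conjugate (inv g) Q}"
      using g sub by (auto simp: inv_mult_group simp flip: conjugate_mult)
    show "(\<lambda>k. k \<otimes> inv g) \<in> {k \<in> carrier G. conjugate (inv k) Q = conjugate (inv g) Q}
        \<rightarrow> {k \<in> carrier G. conjugate (inv k) Q = Q}"
      using g sub by (auto simp: inv_mult_group conjugate_inv_cancel simp flip: conjugate_mult)
  qed (use g in \<open>auto simp: m_assoc\<close>)
  then show ?thesis by (rule bij_betw_same_card[symmetric])
qed

lemma finite_fusion_class:
  assumes "subgroup S G" shows "finite (fusion_class G S Q)"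
proof (rule finite_subset)
  show "fusion_class G S Q \<subseteq> Pow S" by (auto simp: fusion_class_def)
qed (simp add: finite_subgroup assms)

text \<open>Sending \<open>g\<close> to \<open>g\<^sup>-\<^sup>1 Q g\<close> maps the transporter onto the conjugates of \<open>Q\<close> inside \<open>P\<close>, and all fibres
  have the size of the normalizer.\<close>

lemma card_transporter:
  assumes S: "subgroup S G" and Q: "subgroup Q G" and P: "P \<subseteq> S"
  shows "card (transporter Q P)
    = card {k \<in> carrier G. conjugate (inv k) Q = Q} * card {Q' \<in> fusion_class G S Q. Q' \<subseteq> P}"
proof -
  let ?T = "transporter Q P" and ?D = "{Q' \<in> fusion_class G S Q. Q' \<subseteq> P}"
  let ?N = "card {k \<in> carrier G. conjugate (inv k) Q = Q}"
  have fin: "finite ?T" "finite ?D"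
    using finite_carrier finite_fusion_class[OF S] by (auto simp: transporter_def)
  have "card {k \<in> ?T. conjugate (inv k) Q = Q'} = ?N" if Q': "Q' \<in> ?D" for Q'
  proof -
    obtain g where g: "g \<in> carrier G" "Q' = conjugate g Q"
      using Q' Q by (auto simp: fusion_class_iff)
    have "{k \<in> ?T. conjugate (inv k) Q = Q'}
        = {k \<in> carrier G. conjugate (inv k) Q = conjugate (inv (inv g)) Q}"
      using g Q' by (auto simp: transporter_iff)
    then show ?thesis using card_same_conjugate[OF Q, of "inv g"] g by simp
  qed
  moreover have "(\<lambda>k. conjugate (inv k) Q) ` ?T \<subseteq> ?D"
  proof (intro subsetI, elim imageE)
    fix Q' k assume k: "k \<in> ?T" "Q' = conjugate (inv k) Q"
    then have "k \<in> carrier G" "Q' \<subseteq> P" by (simp_all add: transporter_iff)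
    then show "Q' \<in> ?D"
      using P k(2) inv_closed[of k] by (simp add: fusion_class_iff[OF Q]) (blast intro: order_trans)
  qed
  ultimately have "card ?T = (\<Sum>Q'\<in>?D. ?N)"
    using sum.group[OF fin, of "\<lambda>k. conjugate (inv k) Q" "\<lambda>_. 1::nat"] by simp
  then show ?thesis by simp
qed

lemma conjugate_fusion_class:
  assumes S: "subgroup S G" and Q: "subgroup Q G" and s: "s \<in> S"
  shows "bij_betw (conjugate s) (fusion_class G S Q) (fusion_class G S Q)"
proof (rule bij_betwI[where g = "conjugate (inv s)"])
  note QS = subgroup.subset[OF Q] subgroup.mem_carrier[OF S s]
  have maps: "conjugate t \<in> fusion_class G S Q \<rightarrow> fusion_class G S Q" if "t \<in> S" for t
  proof
    fix Q' assume "Q' \<in> fusion_class G S Q"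
    then obtain g where g: "g \<in> carrier G" "Q' = conjugate g Q" "Q' \<subseteq> S"
      using Q by (auto simp: fusion_class_iff)
    have t: "t \<in> carrier G" using S that by (rule subgroup.mem_carrier)
    have "conjugate t Q' \<subseteq> S"
      using conjugate_mono[OF g(3), of t] conjugate_self[OF S that] by blast
    then show "conjugate t Q' \<in> fusion_class G S Q"
      using g t QS by (auto simp: fusion_class_iff[OF Q] conjugate_mult)
  qed
  show "conjugate s \<in> fusion_class G S Q \<rightarrow> fusion_class G S Q"
    "conjugate (inv s) \<in> fusion_class G S Q \<rightarrow> fusion_class G S Q"
    using maps s S by (auto simp: subgroup.m_inv_closed)
  fix Q' assume "Q' \<in> fusion_class G S Q"
  then have "Q' \<subseteq> carrier G" using subgroup.subset[OF S] by (auto simp: fusion_class_def)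
  then show "conjugate (inv s) (conjugate s Q') = Q'" "conjugate s (conjugate (inv s) Q') = Q'"
    using conjugate_inv_cancel QS by auto
qed

text \<open>This counts the pairs \<open>(Q', s)\<close> with \<open>s\<^sup>-\<^sup>1 Q' s \<subseteq> P\<close>. For each \<open>s \<in> S\<close> conjugation permutes the fusion
  class, so the number of suitable \<open>Q'\<close> does not depend on \<open>s\<close>.\<close>

lemma sum_card_transporter:
  assumes S: "subgroup S G" and Q: "subgroup Q G"
  shows "(\<Sum>Q'\<in>fusion_class G S Q. card (group.transporter (G\<lparr>carrier := S\<rparr>) Q' P))
    = card S * card {Q' \<in> fusion_class G S Q. Q' \<subseteq> P}"
proof -
  interpret S: finite_group "G\<lparr>carrier := S\<rparr>" using S by (rule finite_group_subgroup)
  let ?C = "fusion_class G S Q"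
  have T: "S.transporter Q' P = {s \<in> S. conjugate (inv s) Q' \<subseteq> P}" for Q'
    using S by (auto simp: S.transporter_def conjugate_def m_inv_consistent subgroup.mem_carrier)
  have fin: "finite ?C" "finite S" using finite_fusion_class finite_subgroup S by auto
  have "(\<Sum>Q'\<in>?C. card (S.transporter Q' P))
      = (\<Sum>Q'\<in>?C. \<Sum>s\<in>S. if conjugate (inv s) Q' \<subseteq> P then 1 else 0)"
    using fin by (simp add: T sum.If_cases Int_def)
  also have "\<dots> = (\<Sum>s\<in>S. \<Sum>Q'\<in>?C. if conjugate (inv s) Q' \<subseteq> P then 1 else 0)"
    by (rule sum.swap)
  also have "\<dots> = (\<Sum>s\<in>S. \<Sum>Q'\<in>?C. if Q' \<subseteq> P then 1 else 0)"
    by (intro sum.cong refl sum.reindex_bij_betw[OF conjugate_fusion_class[OF S Q],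
          of "inv _" "\<lambda>Q'. if Q' \<subseteq> P then 1 else 0"] subgroup.m_inv_closed[OF S])
  also have "\<dots> = card S * card {Q' \<in> ?C. Q' \<subseteq> P}"
    using fin by (simp add: sum.If_cases Int_def)
  finally show ?thesis .
qed

text \<open>The key count. Let \<open>N\<close> be the order of the normalizer of \<open>Q\<close> in \<open>G\<close> and \<open>c\<close> the number of
  members of the fusion class contained in \<open>P\<close>. Then \<open>\<Phi>\<^sub>Q(G/P) = N c / |P|\<close>, in particular
  \<open>\<Phi>\<^sub>Q(G/S) = N |[Q]| / |S|\<close>, while the sum is \<open>|S| c / |P|\<close>.\<close>

theorem marks_cosets_average:
  assumes S: "subgroup S G" and P: "subgroup P G" "P \<subseteq> S" and Q: "subgroup Q G"
  shows "of_nat (card (fusion_class G S Q)) * marks G (gset_cosets G P) Q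
    = marks G (gset_cosets G S) Q *
      (\<Sum>Q'\<in>fusion_class G S Q. marks (G\<lparr>carrier := S\<rparr>) (gset_cosets (G\<lparr>carrier := S\<rparr>) P) Q')"
proof -
  interpret S: finite_group "G\<lparr>carrier := S\<rparr>" using S by (rule finite_group_subgroup)
  let ?C = "fusion_class G S Q"
  let ?N = "of_nat (card {k \<in> carrier G. conjugate (inv k) Q = Q}) :: rat"
  let ?c = "of_nat (card {Q' \<in> ?C. Q' \<subseteq> P}) :: rat"
  have "{Q' \<in> ?C. Q' \<subseteq> S} = ?C" by (auto simp: fusion_class_def)
  then have 1: "marks G (gset_cosets G S) Q = ?N * of_nat (card ?C) / of_nat (card S)"
    using marks_cosets[OF S Q] card_transporter[OF S Q subset_refl] by simp
  have 2: "marks G (gset_cosets G P) Q = ?N * ?c / of_nat (card P)"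
    using marks_cosets[OF P(1) Q] card_transporter[OF S Q P(2)] by simp
  have "(\<Sum>Q'\<in>?C. marks (G\<lparr>carrier := S\<rparr>) (gset_cosets (G\<lparr>carrier := S\<rparr>) P) Q')
      = (\<Sum>Q'\<in>?C. of_nat (card (S.transporter Q' P))) / of_nat (card P)"
    unfolding sum_divide_distrib
    using S P by (intro sum.cong refl S.marks_cosets)
      (auto simp: subgroup_of_subgroup_iff fusion_class_def)
  also have "\<dots> = of_nat (card S) * ?c / of_nat (card P)"
    by (simp add: sum_card_transporter[OF S Q] flip: of_nat_sum)
  finally have 3: "(\<Sum>Q'\<in>?C. marks (G\<lparr>carrier := S\<rparr>) (gset_cosets (G\<lparr>carrier := S\<rparr>) P) Q')
      = of_nat (card S) * ?c / of_nat (card P)" .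
  have "card S \<noteq> 0"
    using finite_subgroup[OF S] subgroup.one_closed[OF S] by auto
  then show ?thesis unfolding 1 2 3 by simp
qed

text \<open>An orbit of a \<open>p\<close>-group is either a fixed point or has size divisible by \<open>p\<close>.\<close>

lemma card_fixed_cong:
  assumes p: "prime p" and card: "card (carrier G) = p ^ n" and X: "fin_gset G X"
  shows "card (gset_fixed (carrier G) X) mod p = card (fst X) mod p"
proof -
  have carrier: "subgroup (carrier G) G" by (rule subgroup_self)
  define R where "R f \<longleftrightarrow>
    (\<exists>k::int. f (carrier G) - f {\<one>} = of_int (int p * k))" for f :: "'a set \<Rightarrow> rat"
  have "R (marks G X)"
  proof (rule marks_orbit_induct[OF X])
    show "R 0" unfolding R_def by (intro exI[of _ 0]) simp
  next
    fix f x assume x: "x \<in> fst X" and "R f"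
    define H where "H = stabilizer G (snd X) x"
    have H: "subgroup H G" unfolding H_def using X x by (rule stabilizer_subgroup)
    have H0: "card H \<noteq> 0" using finite_subgroup[OF H] subgroup.one_closed[OF H] by auto
    have T1: "transporter {\<one>} H = carrier G"
      using subgroup.one_closed[OF H] by (auto simp: transporter_def)
    have "R (marks G (gset_cosets G H))"
    proof (cases "H = carrier G")
      case True
      then have "transporter (carrier G) H = carrier G" by (auto simp: transporter_def)
      then show ?thesis
        unfolding R_def using marks_cosets[OF H carrier] marks_cosets[OF H triv_subgroup] T1
        by (intro exI[of _ 0]) simp
    next
      case False
      have T0: "transporter (carrier G) H = {}"
      proof (rule ccontr)
        assume "transporter (carrier G) H \<noteq> {}"
        then obtain g where g: "g \<in> carrier G" "\<And>q. q \<in> carrier G \<Longrightarrow> inv g \<otimes> q \<otimes> g \<in> H"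
          by (auto simp: transporter_def)
        have "y \<in> H" if "y \<in> carrier G" for y
          using g(2)[of "g \<otimes> y \<otimes> inv g"] g(1) that
          by (simp add: m_assoc) (simp flip: m_assoc)
        then show False using False subgroup.subset[OF H] by blast
      qed
      obtain d where d: "p ^ n = d * card H"
        using l_lagrange[OF finite_carrier H] card by (metis order_def)
      then have "d dvd p ^ n" "d \<noteq> 1"
        using False card_subset_eq[OF finite_carrier subgroup.subset[OF H]] card by auto
      then have "p dvd d" using p
        by (metis divides_primepow_nat dvd_power gr0I power_0)
      then obtain e where "d = p * e" by (elim dvdE)
      then have "marks G (gset_cosets G H) {\<one>} = of_nat p * of_nat e"
        using marks_cosets[OF H triv_subgroup] T1 card d H0 by simp
      then show ?thesis
        unfolding R_def using marks_cosets[OF H carrier] T0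
        by (intro exI[of _ "- int e"]) simp
    qed
    with \<open>R f\<close> obtain k l :: int where "f (carrier G) - f {\<one>} = of_int (int p * k)"
        "marks G (gset_cosets G H) (carrier G) - marks G (gset_cosets G H) {\<one>} = of_int (int p * l)"
      unfolding R_def by blast
    then show "R (marks G (gset_cosets G (stabilizer G (snd X) x)) + f)"
      unfolding R_def H_def[symmetric] by (intro exI[of _ "k + l"]) (simp add: algebra_simps)
  qed
  then obtain k where "marks G X (carrier G) - marks G X {\<one>} = of_int (int p * k)"
    unfolding R_def by blast
  then have "rat_of_int (int (card (gset_fixed (carrier G) X)) - int (card (fst X)))
      = of_int (int p * k)"
    using carrier marks_trivial_subgroup[OF X] by (simp add: marks_def)
  then have "int (card (gset_fixed (carrier G) X)) - int (card (fst X)) = int p * k"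
    by (simp only: of_int_eq_iff)
  then have "int (card (gset_fixed (carrier G) X)) mod int p = int (card (fst X)) mod int p"
    by (simp add: mod_eq_dvd_iff)
  then show ?thesis by (simp flip: of_nat_mod)
qed

text \<open>Modulo \<open>p\<close> the number of fixed points is the index of \<open>S\<close>.\<close>

lemma sylow_fixed_points:
  assumes p: "prime p" and S: "sylow_subgroup p S G" and Q: "p_subgroup p Q G"
  shows "\<not> p dvd card (gset_fixed Q (gset_cosets G S))"
proof -
  obtain n where sub: "subgroup Q G" and n: "card Q = p ^ n"
    using Q by (auto simp: p_subgroup_def)
  have sS: "subgroup S G" and cS: "card S = p ^ multiplicity p (order G)"
    using S by (auto simp: sylow_subgroup_def)
  interpret Q: finite_group "G\<lparr>carrier := Q\<rparr>" using sub by (rule finite_group_subgroup)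
  have "card (gset_fixed (carrier (G\<lparr>carrier := Q\<rparr>)) (gset_cosets G S)) mod p
      = card (fst (gset_cosets G S)) mod p"
    by (rule Q.card_fixed_cong[OF p]) (simp_all add: n fin_gset_subgroup fin_gset_cosets sS sub)
  then have "card (gset_fixed Q (gset_cosets G S)) mod p = card (lcosets S) mod p"
    by (simp add: fst_gset_cosets)
  moreover have "\<not> p dvd card (lcosets S)"
  proof
    assume "p dvd card (lcosets S)"
    then have "p ^ Suc (multiplicity p (order G)) dvd order G"
      using l_lagrange[OF finite_carrier sS] cS by (metis mult_dvd_mono dvd_refl power_Suc)
    moreover have "order G \<noteq> 0" using finite_carrier by (simp add: order_gt_0_iff_finite)
    ultimately show False
      using p by (metis not_prime_unit not_less_eq_eq order_refl power_dvd_iff_le_multiplicity)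
  qed
  ultimately show ?thesis by (simp add: dvd_eq_mod_eq_0)
qed

text \<open>Sylow's second theorem. A coset \<open>g S\<close> fixed by \<open>Q\<close> gives \<open>g\<^sup>-\<^sup>1 Q g \<subseteq> S\<close>, and one exists as the
  number of them is prime to \<open>p\<close>.\<close>

lemma sylow_conjugate:
  assumes "prime p" "sylow_subgroup p S G" "p_subgroup p Q G"
  obtains g where "g \<in> carrier G" "conjugate g Q \<subseteq> S"
proof -
  have sub: "subgroup S G" "subgroup Q G"
    using assms by (auto simp: sylow_subgroup_def p_subgroup_def)
  have "gset_fixed Q (gset_cosets G S) \<noteq> {}"
    using sylow_fixed_points[OF assms] by force
  then obtain C where C: "C \<in> gset_fixed Q (gset_cosets G S)" by blast
  then obtain g where "g \<in> carrier G" "C = g <# S"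
    by (auto simp: gset_fixed_def fst_gset_cosets elim!: lcosetsE)
  then have "g \<in> transporter Q S" using C coset_fixed_iff[OF sub] by simp
  then show thesis using that[of "inv g"] by (auto simp: transporter_iff)
qed

lemma subgroup_of_p_subgroup:
  assumes "prime p" "p_subgroup p P G" "subgroup H G" "H \<subseteq> P"
  shows "p_subgroup p H G"
proof -
  obtain n where n: "subgroup P G" "card P = p ^ n" using assms by (auto simp: p_subgroup_def)
  interpret P: group "G\<lparr>carrier := P\<rparr>" using n(1) by (rule subgroup_imp_group)
  have "card H dvd card P"
    using P.l_lagrange[of H] finite_subgroup[OF n(1)] assms n(1)
    by (simp add: subgroup_of_subgroup_iff order_def) (metis dvd_triv_right)
  then show ?thesis
    using assms n by (auto simp: p_subgroup_def divides_primepow_nat)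
qed

lemma p_subgroup_conjugate:
  "\<lbrakk>p_subgroup p P G; g \<in> carrier G\<rbrakk> \<Longrightarrow> p_subgroup p (conjugate g P) G"
  by (auto simp: p_subgroup_def subgroup_conjugate card_conjugate subgroup.subset)

end


section \<open>Rings embedded in rings of rational functions\<close>

text \<open>An embedding of a ring, possibly without identity, into a ring of functions with pointwise
  operations. All ring axioms follow from those of the rational numbers. The identity is
  kept apart, because \<open>A(G;p)\<close> need not have one, and the identity of a ring of this kind need not be the
  constant function \<open>1\<close>, because marks vanish at sets that are not subgroups.\<close>

locale ghost_embedding =
  fixes R :: "('r, 'm) ring_scheme" (structure) and \<gamma> :: "'r \<Rightarrow> 'i \<Rightarrow> rat"
  assumes inj: "inj_on \<gamma> (carrier R)"
    and zero_closed: "\<zero> \<in> carrier R" and ghost_zero: "\<gamma> \<zero> = 0"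
    and add_closed: "\<lbrakk>a \<in> carrier R; b \<in> carrier R\<rbrakk> \<Longrightarrow> a \<oplus> b \<in> carrier R"
    and ghost_add: "\<lbrakk>a \<in> carrier R; b \<in> carrier R\<rbrakk> \<Longrightarrow> \<gamma> (a \<oplus> b) = \<gamma> a + \<gamma> b"
    and neg_closed: "a \<in> carrier R \<Longrightarrow> \<exists>b\<in>carrier R. \<gamma> b = - \<gamma> a"
    and mult_closed: "\<lbrakk>a \<in> carrier R; b \<in> carrier R\<rbrakk> \<Longrightarrow> a \<otimes> b \<in> carrier R"
    and ghost_mult: "\<lbrakk>a \<in> carrier R; b \<in> carrier R\<rbrakk> \<Longrightarrow> \<gamma> (a \<otimes> b) = \<gamma> a * \<gamma> b"
begin

lemma eqI: "\<lbrakk>a \<in> carrier R; b \<in> carrier R; \<gamma> a = \<gamma> b\<rbrakk> \<Longrightarrow> a = b"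
  using inj by (simp add: inj_on_def)

lemmas ghost_simps = zero_closed ghost_zero add_closed ghost_add mult_closed ghost_mult

lemma cring:
  assumes one: "\<one> \<in> carrier R" "\<And>a. a \<in> carrier R \<Longrightarrow> \<gamma> \<one> * \<gamma> a = \<gamma> a"
  shows "cring R"
proof (rule cringI)
  show "abelian_group R"
  proof (rule abelian_groupI)
    fix x assume x: "x \<in> carrier R"
    then obtain y where "y \<in> carrier R" "\<gamma> y = - \<gamma> x" using neg_closed by blast
    with x show "\<exists>y\<in>carrier R. y \<oplus> x = \<zero>" by (intro bexI[of _ y] eqI) (auto simp: ghost_simps)
  qed (auto intro!: eqI simp: ghost_simps algebra_simps)
  show "comm_monoid R"
  proof (rule comm_monoidI)
    show "\<one> \<in> carrier R" by (rule one)
    show "\<And>x. x \<in> carrier R \<Longrightarrow> \<one> \<otimes> x = x" by (auto intro!: eqI simp: ghost_simps one)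
  qed (auto intro!: eqI simp: ghost_simps algebra_simps)
qed (auto intro!: eqI simp: ghost_simps algebra_simps)

lemma ghost_a_inv:
  assumes "cring R" "a \<in> carrier R" shows "\<gamma> (\<ominus> a) = - \<gamma> a"
proof -
  interpret cring R by fact
  have "\<gamma> (\<ominus> a) + \<gamma> a = 0"
    using assms by (metis a_inv_closed ghost_add ghost_zero l_neg)
  then show ?thesis by (simp add: eq_neg_iff_add_eq_0)
qed

lemma ghost_nat_multiple:
  assumes "a \<in> carrier R"
  shows "[(n::nat)] \<cdot> a \<in> carrier R" "\<gamma> ([n] \<cdot> a) i = of_nat n * \<gamma> a i"
proof -
  have "[n] \<cdot> a \<in> carrier R \<and> \<gamma> ([n] \<cdot> a) i = of_nat n * \<gamma> a i"
    by (induction n) (use assms in \<open>auto simp: add_pow_def nat_pow_def ghost_simps algebra_simps\<close>)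
  then show "[n] \<cdot> a \<in> carrier R" "\<gamma> ([n] \<cdot> a) i = of_nat n * \<gamma> a i" by auto
qed

lemma ghost_embedding_one_update: "ghost_embedding (R\<lparr>one := e\<rparr>) \<gamma>"
  using ghost_embedding_axioms by (simp add: ghost_embedding_def)

lemma ghost_embedding_subset:
  assumes "A \<subseteq> carrier R" "\<zero> \<in> A" "\<And>a b. \<lbrakk>a \<in> A; b \<in> A\<rbrakk> \<Longrightarrow> a \<oplus> b \<in> A"
    "\<And>a. a \<in> A \<Longrightarrow> \<exists>b\<in>A. \<gamma> b = - \<gamma> a" "\<And>a b. \<lbrakk>a \<in> A; b \<in> A\<rbrakk> \<Longrightarrow> a \<otimes> b \<in> A"
  shows "ghost_embedding (R\<lparr>carrier := A\<rparr>) \<gamma>"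
  using assms(2-) subsetD[OF assms(1)] inj_on_subset[OF inj assms(1)]
  by (auto simp: ghost_embedding_def ghost_simps)

end

text \<open>Rings with the same functions are isomorphic by the map that preserves functions.\<close>

lemma ghost_ring_iso:
  assumes R: "ghost_embedding R \<gamma>" and R': "ghost_embedding R' \<gamma>'"
    and image: "\<gamma> ` carrier R = \<gamma>' ` carrier R'"
    and one: "\<one>\<^bsub>R\<^esub> \<in> carrier R" "\<one>\<^bsub>R'\<^esub> \<in> carrier R'" "\<gamma> \<one>\<^bsub>R\<^esub> = \<gamma>' \<one>\<^bsub>R'\<^esub>"
  obtains h where "h \<in> ring_iso R R'" "\<And>a. a \<in> carrier R \<Longrightarrow> \<gamma>' (h a) = \<gamma> a"
proof -
  interpret R: ghost_embedding R \<gamma> by fact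
  interpret R': ghost_embedding R' \<gamma>' by fact
  define h where "h a = inv_into (carrier R') \<gamma>' (\<gamma> a)" for a
  have h: "h a \<in> carrier R'" "\<gamma>' (h a) = \<gamma> a" if "a \<in> carrier R" for a
    using that image unfolding h_def by (metis imageI inv_into_into, metis f_inv_into_f imageI)
  have "h \<in> ring_hom R R'"
    by (rule ring_hom_memI) (auto intro!: R'.eqI simp: h R.ghost_simps R'.ghost_simps one)
  moreover have "inj_on h (carrier R)"
    by (rule inj_onI) (metis h(2) R.eqI)
  moreover have "b \<in> h ` carrier R" if b: "b \<in> carrier R'" for b
  proof -
    obtain a where "a \<in> carrier R" "\<gamma> a = \<gamma>' b" using b image by (metis imageE imageI)
    then show ?thesis using b h by (intro image_eqI[of _ _ a] R'.eqI) auto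
  qed
  ultimately have "h \<in> ring_iso R R'"
    using h(1) by (auto simp: ring_iso_def bij_betw_def)
  then show thesis using that h(2) by blast
qed


section \<open>Localization\<close>

text \<open>A fraction is a set of pairs on which the quotient is constant. The formula is the one that
  defines \<^const>\<open>loc_mark\<close>, with \<open>\<gamma>\<close> in place of the marks.\<close>

definition loc_ghost :: "('r \<Rightarrow> 'i \<Rightarrow> rat) \<Rightarrow> ('r \<times> nat) set \<Rightarrow> 'i \<Rightarrow> rat" where
  "loc_ghost \<gamma> x i = the_elem ((\<lambda>(a, n). \<gamma> a i / of_nat n) ` x)"

lemma coprime_prime_nonzero:
  fixes k p :: nat
  shows "\<lbrakk>prime p; coprime k p\<rbrakk> \<Longrightarrow> k \<noteq> 0"
  by (metis coprime_0_left_iff not_prime_unit)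

lemma UN_eq_const: "\<lbrakk>x \<noteq> {}; \<And>z. z \<in> x \<Longrightarrow> F z = c\<rbrakk> \<Longrightarrow> (\<Union>z\<in>x. F z) = c"
  by auto

context ghost_embedding
begin

text \<open>Rings of functions are torsion-free, so the factor \<open>k\<close> in the definition of equality of fractions
  cancels.\<close>

lemma mem_loc_frac_iff:
  assumes p: "prime p" and a: "a \<in> carrier R" and n: "coprime n p"
  shows "(b, m) \<in> loc_frac p R a n \<longleftrightarrow>
    b \<in> carrier R \<and> coprime m p \<and> (\<forall>i. \<gamma> b i / of_nat m = \<gamma> a i / of_nat n)"
proof -
  note pos = coprime_prime_nonzero[OF p]
  have "(\<exists>k::nat. coprime k p \<and> [(k * m)] \<cdot> a = [(k * n)] \<cdot> b) \<longleftrightarrow>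
        (\<forall>i. \<gamma> b i / of_nat m = \<gamma> a i / of_nat n)"
    if b: "b \<in> carrier R" and m: "coprime m p"
  proof -
    have "[(k * m)] \<cdot> a = [(k * n)] \<cdot> b \<longleftrightarrow> (\<forall>i. \<gamma> b i / of_nat m = \<gamma> a i / of_nat n)"
      if k: "coprime k p" for k :: nat
    proof -
      have "[(k * m)] \<cdot> a = [(k * n)] \<cdot> b \<longleftrightarrow> \<gamma> ([(k * m)] \<cdot> a) = \<gamma> ([(k * n)] \<cdot> b)"
        using a b ghost_nat_multiple(1) eqI by metis
      also have "\<dots> \<longleftrightarrow> (\<forall>i. of_nat (k * m) * \<gamma> a i = of_nat (k * n) * \<gamma> b i)"
        using a b by (auto simp: ghost_nat_multiple fun_eq_iff)
      also have "\<dots> \<longleftrightarrow> (\<forall>i. \<gamma> b i / of_nat m = \<gamma> a i / of_nat n)"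
        using pos[OF k] pos[OF m] pos[OF n] by (auto simp: field_simps)
      finally show ?thesis .
    qed
    then show ?thesis by (metis coprime_1_left)
  qed
  then show ?thesis by (auto simp: loc_frac_def)
qed

lemma loc_ghost_frac:
  assumes "prime p" "a \<in> carrier R" "coprime n p"
  shows "loc_ghost \<gamma> (loc_frac p R a n) = (\<lambda>i. \<gamma> a i / of_nat n)"
proof
  fix i
  have "(\<lambda>(a, n). \<gamma> a i / of_nat n) ` loc_frac p R a n = {\<gamma> a i / of_nat n}"
  proof (intro equalityI subsetI)
    fix y assume "y \<in> {\<gamma> a i / of_nat n}"
    moreover have "(a, n) \<in> loc_frac p R a n" using assms by (simp add: mem_loc_frac_iff)
    ultimately show "y \<in> (\<lambda>(a, n). \<gamma> a i / of_nat n) ` loc_frac p R a n" by force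
  qed (use assms in \<open>auto simp: mem_loc_frac_iff\<close>)
  then show "loc_ghost \<gamma> (loc_frac p R a n) i = \<gamma> a i / of_nat n"
    by (simp add: loc_ghost_def)
qed

lemma loc_frac_cong:
  assumes "prime p" "a \<in> carrier R" "coprime n p" "b \<in> carrier R" "coprime m p"
    and "\<And>i. \<gamma> a i / of_nat n = \<gamma> b i / of_nat m"
  shows "loc_frac p R a n = loc_frac p R b m"
  using assms by (auto simp: mem_loc_frac_iff)

lemma localize_carrierE:
  assumes "x \<in> carrier (localize p R)"
  obtains a n where "x = loc_frac p R a n" "a \<in> carrier R" "coprime n p"
  using assms by (auto simp: localize_def)

lemma loc_frac_closed:
  "\<lbrakk>a \<in> carrier R; coprime n p\<rbrakk> \<Longrightarrow> loc_frac p R a n \<in> carrier (localize p R)"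
  by (auto simp: localize_def)

lemma loc_frac_add:
  assumes p: "prime p" and a: "a \<in> carrier R" "coprime n p" and b: "b \<in> carrier R" "coprime m p"
  shows "loc_frac p R a n \<oplus>\<^bsub>localize p R\<^esub> loc_frac p R b m
    = loc_frac p R ([m] \<cdot> a \<oplus> [n] \<cdot> b) (n * m)"
proof -
  note pos = coprime_prime_nonzero[OF p]
  have ne: "loc_frac p R a n \<noteq> {}" "loc_frac p R b m \<noteq> {}"
    using mem_loc_frac_iff[OF p a, of a n] mem_loc_frac_iff[OF p b, of b m] a b by auto
  have "loc_frac p R ([m'] \<cdot> a' \<oplus> [n'] \<cdot> b') (n' * m')
      = loc_frac p R ([m] \<cdot> a \<oplus> [n] \<cdot> b) (n * m)"
    if "(a', n') \<in> loc_frac p R a n" "(b', m') \<in> loc_frac p R b m" for a' n' b' m'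
  proof (rule loc_frac_cong[OF p])
    have *: "a' \<in> carrier R" "coprime n' p" "\<gamma> a' i / of_nat n' = \<gamma> a i / of_nat n"
      "b' \<in> carrier R" "coprime m' p" "\<gamma> b' i / of_nat m' = \<gamma> b i / of_nat m" for i
      using that a b by (simp_all add: mem_loc_frac_iff[OF p])
    show "coprime (n' * m') p" "coprime (n * m) p" using * a b by auto
    show "[m'] \<cdot> a' \<oplus> [n'] \<cdot> b' \<in> carrier R" "[m] \<cdot> a \<oplus> [n] \<cdot> b \<in> carrier R"
      using * a b by (simp_all add: ghost_nat_multiple add_closed)
    show "\<gamma> ([m'] \<cdot> a' \<oplus> [n'] \<cdot> b') i / of_nat (n' * m')
        = \<gamma> ([m] \<cdot> a \<oplus> [n] \<cdot> b) i / of_nat (n * m)" for i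
    proof -
      have "\<gamma> ([m'] \<cdot> a' \<oplus> [n'] \<cdot> b') i / of_nat (n' * m')
          = \<gamma> a' i / of_nat n' + \<gamma> b' i / of_nat m'"
        using pos[OF *(2)] pos[OF *(5)] *(1,4)
        by (simp add: ghost_nat_multiple ghost_add field_simps)
      also have "\<dots> = \<gamma> a i / of_nat n + \<gamma> b i / of_nat m" by (simp only: *)
      also have "\<dots> = \<gamma> ([m] \<cdot> a \<oplus> [n] \<cdot> b) i / of_nat (n * m)"
        using pos[OF a(2)] pos[OF b(2)] a b
        by (simp add: ghost_nat_multiple ghost_add field_simps)
      finally show ?thesis .
    qed
  qed
  then show ?thesis
    unfolding localize_def ring_record_simps by (intro UN_eq_const ne) (auto intro!: UN_eq_const ne)
qed

lemma loc_frac_mult: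
  assumes p: "prime p" and a: "a \<in> carrier R" "coprime n p" and b: "b \<in> carrier R" "coprime m p"
  shows "loc_frac p R a n \<otimes>\<^bsub>localize p R\<^esub> loc_frac p R b m = loc_frac p R (a \<otimes> b) (n * m)"
proof -
  have ne: "loc_frac p R a n \<noteq> {}" "loc_frac p R b m \<noteq> {}"
    using mem_loc_frac_iff[OF p a, of a n] mem_loc_frac_iff[OF p b, of b m] a b by auto
  have "loc_frac p R (a' \<otimes> b') (n' * m') = loc_frac p R (a \<otimes> b) (n * m)"
    if "(a', n') \<in> loc_frac p R a n" "(b', m') \<in> loc_frac p R b m" for a' n' b' m'
  proof (rule loc_frac_cong[OF p])
    have *: "a' \<in> carrier R" "coprime n' p" "\<gamma> a' i / of_nat n' = \<gamma> a i / of_nat n"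
      "b' \<in> carrier R" "coprime m' p" "\<gamma> b' i / of_nat m' = \<gamma> b i / of_nat m" for i
      using that a b by (simp_all add: mem_loc_frac_iff[OF p])
    show "coprime (n' * m') p" "coprime (n * m) p" using * a b by auto
    show "a' \<otimes> b' \<in> carrier R" "a \<otimes> b \<in> carrier R"
      using * a b by (simp_all add: mult_closed)
    show "\<gamma> (a' \<otimes> b') i / of_nat (n' * m') = \<gamma> (a \<otimes> b) i / of_nat (n * m)" for i
      using *(1,4) a b arg_cong2[OF *(3)[of i] *(6)[of i], of "(*)"] by (simp add: ghost_mult)
  qed
  then show ?thesis
    unfolding localize_def ring_record_simps by (intro UN_eq_const ne) (auto intro!: UN_eq_const ne)
qed

theorem ghost_embedding_localize:
  assumes p: "prime p"
  shows "ghost_embedding (localize p R) (loc_ghost \<gamma>)"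
proof
  note pos = coprime_prime_nonzero[OF p]
  have zero: "\<zero>\<^bsub>localize p R\<^esub> = loc_frac p R \<zero> 1" by (simp add: localize_def)
  show "\<zero>\<^bsub>localize p R\<^esub> \<in> carrier (localize p R)" "loc_ghost \<gamma> \<zero>\<^bsub>localize p R\<^esub> = 0"
    using p by (auto simp: zero loc_frac_closed loc_ghost_frac ghost_simps)
  show "inj_on (loc_ghost \<gamma>) (carrier (localize p R))"
  proof (rule inj_onI)
    fix x y assume "x \<in> carrier (localize p R)" "y \<in> carrier (localize p R)"
      and eq: "loc_ghost \<gamma> x = loc_ghost \<gamma> y"
    then obtain a n b m where x: "x = loc_frac p R a n" and a: "a \<in> carrier R" "coprime n p"
      and y: "y = loc_frac p R b m" and b: "b \<in> carrier R" "coprime m p"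
      by (elim localize_carrierE)
    show "x = y"
      unfolding x y using fun_cong[OF eq] a b
      by (intro loc_frac_cong[OF p]) (auto simp: x y loc_ghost_frac[OF p])
  qed
  fix x y assume "x \<in> carrier (localize p R)" "y \<in> carrier (localize p R)"
  then obtain a n b m where x: "x = loc_frac p R a n" and a: "a \<in> carrier R" "coprime n p"
    and y: "y = loc_frac p R b m" and b: "b \<in> carrier R" "coprime m p"
    by (elim localize_carrierE)
  show "x \<oplus>\<^bsub>localize p R\<^esub> y \<in> carrier (localize p R)"
    "x \<otimes>\<^bsub>localize p R\<^esub> y \<in> carrier (localize p R)"
    using a b by (simp_all add: x y loc_frac_add[OF p] loc_frac_mult[OF p] loc_frac_closed
        ghost_simps ghost_nat_multiple)
  show "loc_ghost \<gamma> (x \<oplus>\<^bsub>localize p R\<^esub> y) = loc_ghost \<gamma> x + loc_ghost \<gamma> y"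
    using a b pos[OF a(2)] pos[OF b(2)]
    by (auto simp: x y loc_frac_add[OF p] loc_ghost_frac[OF p] ghost_simps ghost_nat_multiple
        fun_eq_iff field_simps)
  show "loc_ghost \<gamma> (x \<otimes>\<^bsub>localize p R\<^esub> y) = loc_ghost \<gamma> x * loc_ghost \<gamma> y"
    using a b by (auto simp: x y loc_frac_mult[OF p] loc_ghost_frac[OF p] ghost_simps fun_eq_iff)
next
  fix x assume "x \<in> carrier (localize p R)"
  then obtain a n where x: "x = loc_frac p R a n" and a: "a \<in> carrier R" "coprime n p"
    by (elim localize_carrierE)
  obtain b where "b \<in> carrier R" "\<gamma> b = - \<gamma> a" using neg_closed a by blast
  then show "\<exists>y\<in>carrier (localize p R). loc_ghost \<gamma> y = - loc_ghost \<gamma> x"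
    using a by (intro bexI[of _ "loc_frac p R b n"])
      (auto simp: x loc_frac_closed loc_ghost_frac[OF p] fun_eq_iff)
qed

end


section \<open>The Burnside ring and its marks\<close>

definition ghost :: "('a, 'm) monoid_scheme \<Rightarrow> 'a virt \<Rightarrow> 'a set \<Rightarrow> rat" where
  "ghost G c Q = (if subgroup Q G then of_int (mark Q c) else 0)"

context finite_group
begin

text \<open>By Burnside's theorem the summand \<open>Z\<close> in the definition of formal differences can be taken to
  be empty. From here on classes are handled through marks only.\<close>

lemma mem_gset_diff_iff:
  assumes X: "fin_gset G X" and Y: "fin_gset G Y"
  shows "(X', Y') \<in> gset_diff G X Y \<longleftrightarrow>
    fin_gset G X' \<and> fin_gset G Y' \<and> marks G X' - marks G Y' = marks G X - marks G Y"
proof -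
  have "(\<exists>Z :: ('a, nat) gset. fin_gset G Z \<and>
        gset_iso G (gset_sum (gset_sum X Y') Z) (gset_sum (gset_sum X' Y) Z)) \<longleftrightarrow>
      marks G X + marks G Y' = marks G X' + marks G Y" (is "?L \<longleftrightarrow> ?R")
    if X': "fin_gset G X'" and Y': "fin_gset G Y'"
  proof
    assume ?L
    then obtain Z :: "('a, nat) gset" where Z: "fin_gset G Z"
      "gset_iso G (gset_sum (gset_sum X Y') Z) (gset_sum (gset_sum X' Y) Z)" by blast
    have "marks G (gset_sum (gset_sum X Y') Z) = marks G (gset_sum (gset_sum X' Y) Z)"
      using X Y X' Y' Z by (intro gset_iso_imp_marks_eq fin_gset_sum)
    then show ?R using X Y X' Y' Z(1) by (simp add: marks_sum fin_gset_sum)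
  next
    assume ?R
    then have "gset_iso G (gset_sum (gset_sum X Y') gset_empty)
        (gset_sum (gset_sum X' Y) gset_empty)"
      using X Y X' Y'
      by (intro marks_eq_imp_gset_iso fin_gset_sum fin_gset_empty)
        (simp_all add: marks_sum fin_gset_sum fin_gset_empty)
    then show ?L using fin_gset_empty by blast
  qed
  moreover have "marks G X + marks G Y' = marks G X' + marks G Y \<longleftrightarrow>
      marks G X' - marks G Y' = marks G X - marks G Y"
    by (auto simp: fun_eq_iff algebra_simps)
  ultimately show ?thesis by (auto simp: gset_diff_def)
qed

lemma gset_diff_cong:
  assumes "fin_gset G X" "fin_gset G Y" "fin_gset G X'" "fin_gset G Y'"
    and "marks G X - marks G Y = marks G X' - marks G Y'"
  shows "gset_diff G X Y = gset_diff G X' Y'"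
  using assms by (auto simp: mem_gset_diff_iff)

lemma gset_diff_representative:
  assumes X: "fin_gset G X" and Y: "fin_gset G Y"
  obtains X' Y' :: "('a, nat) gset" where "(X', Y') \<in> gset_diff G X Y"
    "fin_gset G X'" "fin_gset G Y'" "marks G X' - marks G Y' = marks G X - marks G Y"
proof -
  obtain X' Y' :: "('a, nat) gset" where X': "fin_gset G X'" "gset_iso G X X'"
    and Y': "fin_gset G Y'" "gset_iso G Y Y'"
    using fin_gset_nat_model[OF X] fin_gset_nat_model[OF Y] by metis
  then have "marks G X' - marks G Y' = marks G X - marks G Y"
    using gset_iso_imp_marks_eq X Y by metis
  with X' Y' show thesis using that X Y by (simp add: mem_gset_diff_iff)
qed

lemma gset_diff_nonempty: "\<lbrakk>fin_gset G X; fin_gset G Y\<rbrakk> \<Longrightarrow> gset_diff G X Y \<noteq> {}"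
  using gset_diff_representative[of X Y] by blast

lemma mark_gset_diff:
  assumes X: "fin_gset G X" and Y: "fin_gset G Y" and Q: "subgroup Q G"
  shows "mark Q (gset_diff G X Y) = int (card (gset_fixed Q X)) - int (card (gset_fixed Q Y))"
proof -
  have "int (card (gset_fixed Q X')) - int (card (gset_fixed Q Y'))
      = int (card (gset_fixed Q X)) - int (card (gset_fixed Q Y))"
    if "(X', Y') \<in> gset_diff G X Y" for X' Y'
  proof -
    have "(marks G X' - marks G Y') Q = (marks G X - marks G Y) Q"
      using that X Y by (simp add: mem_gset_diff_iff)
    then have "rat_of_int (int (card (gset_fixed Q X')) - int (card (gset_fixed Q Y')))
      = rat_of_int (int (card (gset_fixed Q X)) - int (card (gset_fixed Q Y)))"
      using Q by (simp add: marks_def)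
    then show ?thesis by (simp only: of_int_eq_iff)
  qed
  then have const: "(case z of (X', Y') \<Rightarrow>
        int (card (gset_fixed Q X')) - int (card (gset_fixed Q Y')))
      = int (card (gset_fixed Q X)) - int (card (gset_fixed Q Y))"
    if "z \<in> gset_diff G X Y" for z
    using that by (cases z) auto
  have "(\<lambda>(X, Y). int (card (gset_fixed Q X)) - int (card (gset_fixed Q Y))) ` gset_diff G X Y
      = (\<lambda>_. int (card (gset_fixed Q X)) - int (card (gset_fixed Q Y))) ` gset_diff G X Y"
    by (rule image_cong) (rule refl, rule const)
  also have "\<dots> = {int (card (gset_fixed Q X)) - int (card (gset_fixed Q Y))}"
    using gset_diff_nonempty[OF X Y] by (simp add: image_constant_conv)
  finally show ?thesis by (simp add: mark_def)
qed

lemma ghost_gset_diff: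
  "\<lbrakk>fin_gset G X; fin_gset G Y\<rbrakk> \<Longrightarrow> ghost G (gset_diff G X Y) = marks G X - marks G Y"
  by (auto simp: ghost_def marks_def mark_gset_diff fun_eq_iff)

lemma gset_diff_closed:
  assumes "fin_gset G X" "fin_gset G Y"
  shows "gset_diff G X Y \<in> carrier (burnside G)"
proof -
  obtain X' Y' :: "('a, nat) gset" where "fin_gset G X'" "fin_gset G Y'"
      "marks G X' - marks G Y' = marks G X - marks G Y"
    by (rule gset_diff_representative[OF assms])
  moreover from this have "gset_diff G X Y = gset_diff G X' Y'"
    using assms by (intro gset_diff_cong) auto
  ultimately show ?thesis
    unfolding burnside_def partial_object.simps mem_Collect_eq by blast
qed

lemma burnsideE:
  assumes "c \<in> carrier (burnside G)"
  obtains X Y :: "('a, nat) gset" where "fin_gset G X" "fin_gset G Y" "c = gset_diff G X Y"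
  using assms by (auto simp: burnside_def)

lemma marks_sum_difference:
  assumes "fin_gset G X" "fin_gset G Y" "fin_gset G X'" "fin_gset G Y'"
  shows "marks G (gset_sum X X') - marks G (gset_sum Y Y')
    = (marks G X - marks G Y) + (marks G X' - marks G Y')"
  using assms by (simp add: marks_sum)

lemma marks_product_difference:
  assumes "fin_gset G X" "fin_gset G Y" "fin_gset G X'" "fin_gset G Y'"
  shows "marks G (gset_sum (gset_prod X X') (gset_prod Y Y'))
      - marks G (gset_sum (gset_prod X Y') (gset_prod Y X'))
    = (marks G X - marks G Y) * (marks G X' - marks G Y')"
  using assms by (simp add: marks_sum fin_gset_prod marks_prod fun_eq_iff algebra_simps)

lemma burnside_add:
  assumes X: "fin_gset G X" "fin_gset G Y" and X': "fin_gset G X'" "fin_gset G Y'"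
  shows "gset_diff G X Y \<oplus>\<^bsub>burnside G\<^esub> gset_diff G X' Y'
    = gset_diff G (gset_sum X X') (gset_sum Y Y')"
proof -
  have "gset_diff G (gset_sum A A') (gset_sum B B') = gset_diff G (gset_sum X X') (gset_sum Y Y')"
    if "(A, B) \<in> gset_diff G X Y" "(A', B') \<in> gset_diff G X' Y'" for A B A' B'
    using that X X'
    by (intro gset_diff_cong) (simp_all add: mem_gset_diff_iff fin_gset_sum marks_sum_difference)
  then show ?thesis
    unfolding burnside_def ring_record_simps
    using gset_diff_nonempty[OF X] gset_diff_nonempty[OF X'] by (intro UN_eq_const) (auto intro!: UN_eq_const)
qed

lemma burnside_mult:
  assumes X: "fin_gset G X" "fin_gset G Y" and X': "fin_gset G X'" "fin_gset G Y'"
  shows "gset_diff G X Y \<otimes>\<^bsub>burnside G\<^esub> gset_diff G X' Y'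
    = gset_diff G (gset_sum (gset_prod X X') (gset_prod Y Y'))
                  (gset_sum (gset_prod X Y') (gset_prod Y X'))"
proof -
  have "gset_diff G (gset_sum (gset_prod A A') (gset_prod B B'))
                  (gset_sum (gset_prod A B') (gset_prod B A'))
      = gset_diff G (gset_sum (gset_prod X X') (gset_prod Y Y'))
                  (gset_sum (gset_prod X Y') (gset_prod Y X'))"
    if A: "(A, B) \<in> gset_diff G X Y" and A': "(A', B') \<in> gset_diff G X' Y'" for A B A' B'
  proof (rule gset_diff_cong)
    note * = A[unfolded mem_gset_diff_iff[OF X]] A'[unfolded mem_gset_diff_iff[OF X']]
    show "marks G (gset_sum (gset_prod A A') (gset_prod B B'))
          - marks G (gset_sum (gset_prod A B') (gset_prod B A'))
        = marks G (gset_sum (gset_prod X X') (gset_prod Y Y'))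
          - marks G (gset_sum (gset_prod X Y') (gset_prod Y X'))"
      using * X X' by (simp add: marks_product_difference)
  qed (use A A' X X' in \<open>auto simp: mem_gset_diff_iff intro!: fin_gset_sum fin_gset_prod\<close>)
  then show ?thesis
    unfolding burnside_def ring_record_simps
    using gset_diff_nonempty[OF X] gset_diff_nonempty[OF X'] by (intro UN_eq_const) (auto intro!: UN_eq_const)
qed

theorem ghost_embedding_burnside: "ghost_embedding (burnside G) (ghost G)"
proof
  have zero: "\<zero>\<^bsub>burnside G\<^esub> = gset_class G gset_empty" by (simp add: burnside_def)
  show "\<zero>\<^bsub>burnside G\<^esub> \<in> carrier (burnside G)" "ghost G \<zero>\<^bsub>burnside G\<^esub> = 0"
    by (simp_all add: zero gset_diff_closed ghost_gset_diff fin_gset_empty)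
  show "inj_on (ghost G) (carrier (burnside G))"
    by (rule inj_onI, elim burnsideE) (simp add: ghost_gset_diff, rule gset_diff_cong, simp_all)
next
  fix c d assume "c \<in> carrier (burnside G)" "d \<in> carrier (burnside G)"
  then obtain X Y X' Y' :: "('a, nat) gset" where fin: "fin_gset G X" "fin_gset G Y"
      "fin_gset G X'" "fin_gset G Y'" and cd: "c = gset_diff G X Y" "d = gset_diff G X' Y'"
    by (elim burnsideE)
  show "c \<oplus>\<^bsub>burnside G\<^esub> d \<in> carrier (burnside G)" "c \<otimes>\<^bsub>burnside G\<^esub> d \<in> carrier (burnside G)"
    using fin by (auto simp: cd burnside_add burnside_mult
        intro!: gset_diff_closed fin_gset_sum fin_gset_prod)
  show "ghost G (c \<oplus>\<^bsub>burnside G\<^esub> d) = ghost G c + ghost G d"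
    using fin by (simp add: cd burnside_add ghost_gset_diff fin_gset_sum marks_sum)
  show "ghost G (c \<otimes>\<^bsub>burnside G\<^esub> d) = ghost G c * ghost G d"
    using fin by (simp add: cd burnside_mult ghost_gset_diff fin_gset_sum fin_gset_prod marks_sum
        marks_prod fun_eq_iff algebra_simps)
next
  fix c assume "c \<in> carrier (burnside G)"
  then obtain X Y :: "('a, nat) gset" where "fin_gset G X" "fin_gset G Y" "c = gset_diff G X Y"
    by (elim burnsideE)
  then show "\<exists>d\<in>carrier (burnside G). ghost G d = - ghost G c"
    by (intro bexI[of _ "gset_diff G Y X"]) (simp_all add: ghost_gset_diff gset_diff_closed)
qed

lemma burnside_one:
  "\<one>\<^bsub>burnside G\<^esub> \<in> carrier (burnside G)"
  "ghost G \<one>\<^bsub>burnside G\<^esub> = (\<lambda>Q. if subgroup Q G then 1 else 0)"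
  using fin_gset_point fin_gset_empty
  by (simp_all add: burnside_def ghost_gset_diff marks_empty marks_point)
    (use gset_diff_closed in \<open>simp add: burnside_def\<close>)

lemma cring_burnside: "cring (burnside G)"
  by (rule ghost_embedding.cring[OF ghost_embedding_burnside burnside_one(1)])
    (auto simp: fun_eq_iff burnside_one(2) ghost_def)

lemma trans_class_closed: "subgroup H G \<Longrightarrow> trans_class G H \<in> carrier (burnside G)"
  unfolding trans_class_def by (intro gset_diff_closed fin_gset_cosets fin_gset_empty)

lemma ghost_trans_class: "subgroup H G \<Longrightarrow> ghost G (trans_class G H) = marks G (gset_cosets G H)"
  unfolding trans_class_def by (simp add: ghost_gset_diff fin_gset_cosets fin_gset_empty marks_empty)

lemma ghost_conjugate:
  assumes "c \<in> carrier (burnside G)" "g \<in> carrier G" "subgroup Q G"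
  shows "ghost G c (conjugate g Q) = ghost G c Q"
  using assms(1)
  by (elim burnsideE) (simp add: ghost_gset_diff marks_def subgroup_conjugate gset_fixed_conjugate assms)

end


section \<open>The ring \<open>A(G;p)\<close>\<close>

context finite_group
begin

abbreviation (input) "p_trans_classes p \<equiv> {trans_class G P | P. p_subgroup p P G}"

lemma subgroup_burnside_p:
  "subgroup (carrier (burnside_p p G)) (add_monoid (burnside G))"
proof -
  interpret cring "burnside G" by (rule cring_burnside)
  show ?thesis
    unfolding burnside_p_def
    using add.generate_is_subgroup[of "p_trans_classes p"] trans_class_closed
    by (auto simp: p_subgroup_def)
qed

lemma burnside_p_subset: "carrier (burnside_p p G) \<subseteq> carrier (burnside G)"
  using subgroup.subset[OF subgroup_burnside_p] by simp

lemma burnside_p_zero: "\<zero>\<^bsub>burnside G\<^esub> \<in> carrier (burnside_p p G)"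
  using subgroup.one_closed[OF subgroup_burnside_p] by simp

lemma burnside_p_add:
  "\<lbrakk>c \<in> carrier (burnside_p p G); d \<in> carrier (burnside_p p G)\<rbrakk>
     \<Longrightarrow> c \<oplus>\<^bsub>burnside G\<^esub> d \<in> carrier (burnside_p p G)"
  using subgroup.m_closed[OF subgroup_burnside_p] by simp

lemma burnside_p_neg:
  "c \<in> carrier (burnside_p p G) \<Longrightarrow> \<ominus>\<^bsub>burnside G\<^esub> c \<in> carrier (burnside_p p G)"
  using subgroup.m_inv_closed[OF subgroup_burnside_p] by (simp add: a_inv_def)

lemma burnside_p_trans_class: "p_subgroup p P G \<Longrightarrow> trans_class G P \<in> carrier (burnside_p p G)"
  unfolding burnside_p_def by (auto intro: generate.incl)

lemma burnside_p_induct [consumes 1, case_names zero trans neg add]: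
  assumes "c \<in> carrier (burnside_p p G)"
    and "P \<zero>\<^bsub>burnside G\<^esub>" "\<And>H. p_subgroup p H G \<Longrightarrow> P (trans_class G H)"
    and "\<And>c. \<lbrakk>c \<in> carrier (burnside_p p G); P c\<rbrakk> \<Longrightarrow> P (\<ominus>\<^bsub>burnside G\<^esub> c)"
    and "\<And>c d. \<lbrakk>c \<in> carrier (burnside_p p G); P c; d \<in> carrier (burnside_p p G); P d\<rbrakk>
            \<Longrightarrow> P (c \<oplus>\<^bsub>burnside G\<^esub> d)"
  shows "P c"
proof -
  have "c \<in> generate (add_monoid (burnside G)) (p_trans_classes p)"
    using assms(1) by (simp add: burnside_p_def)
  then have "c \<in> carrier (burnside_p p G) \<and> P c"
  proof (induction rule: generate.induct)
    case (inv h)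
    then show ?case
      using assms(3,4) burnside_p_neg burnside_p_trans_class by (auto simp: a_inv_def)
  qed (use assms burnside_p_zero burnside_p_add burnside_p_trans_class in auto)
  then show ?thesis ..
qed

text \<open>Each orbit of such a \<open>G\<close>-set is \<open>G/H\<close> for a point stabilizer \<open>H\<close>, hence one of the generators
  of \<open>A(G;p)\<close>.\<close>

lemma marks_p_isotropy:
  assumes X: "fin_gset G X"
    and p: "\<And>x. x \<in> fst X \<Longrightarrow> p_subgroup p (stabilizer G (snd X) x) G"
  shows "\<exists>c\<in>carrier (burnside_p p G). ghost G c = marks G X"
proof (rule marks_orbit_induct[OF X])
  interpret ghost_embedding "burnside G" "ghost G" by (rule ghost_embedding_burnside)
  show "\<exists>c\<in>carrier (burnside_p p G). ghost G c = 0" using burnside_p_zero ghost_zero by blast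
  fix f x assume x: "x \<in> fst X" and "\<exists>c\<in>carrier (burnside_p p G). ghost G c = f"
  then obtain c where c: "c \<in> carrier (burnside_p p G)" "ghost G c = f" by blast
  let ?d = "trans_class G (stabilizer G (snd X) x)"
  have "?d \<in> carrier (burnside_p p G)" using p x by (intro burnside_p_trans_class)
  moreover have "ghost G ?d = marks G (gset_cosets G (stabilizer G (snd X) x))"
    using p x by (simp add: ghost_trans_class p_subgroup_def)
  ultimately show "\<exists>c\<in>carrier (burnside_p p G).
      ghost G c = marks G (gset_cosets G (stabilizer G (snd X) x)) + f"
    using c burnside_p_subset
    by (intro bexI[of _ "?d \<oplus>\<^bsub>burnside G\<^esub> c"]) (auto simp: burnside_p_add subset_iff ghost_add)
qed

text \<open>A coset \<open>g P\<close> is fixed exactly by the subgroups of \<open>g P g\<^sup>-\<^sup>1\<close>.\<close>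

lemma marks_cosets_nonzero:
  assumes P: "subgroup P G" and Q: "subgroup Q G" and nz: "marks G (gset_cosets G P) Q \<noteq> 0"
  obtains g where "g \<in> carrier G" "Q \<subseteq> conjugate g P"
proof -
  have "transporter Q P \<noteq> {}" using marks_cosets[OF P Q] nz by auto
  then obtain g where g: "g \<in> carrier G" "conjugate (inv g) Q \<subseteq> P" by (auto simp: transporter_iff)
  then have "Q \<subseteq> conjugate g P"
    using conjugate_mono[OF g(2), of g] conjugate_inv_cancel(2)[OF g(1) subgroup.subset[OF Q]] by simp
  with g show thesis using that by blast
qed

text \<open>A subgroup that fixes a point of \<open>G/P \<times> G/H\<close> fixes one of \<open>G/P\<close>. It lies therefore in a
  conjugate of \<open>P\<close> and is a \<open>p\<close>-group.\<close>

lemma trans_class_mult_closed: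
  assumes p: "prime p" and P: "p_subgroup p P G" and H: "p_subgroup p H G"
  shows "trans_class G P \<otimes>\<^bsub>burnside G\<^esub> trans_class G H \<in> carrier (burnside_p p G)"
proof -
  interpret ghost_embedding "burnside G" "ghost G" by (rule ghost_embedding_burnside)
  have sub: "subgroup P G" "subgroup H G" using P H by (auto simp: p_subgroup_def)
  let ?X = "gset_prod (gset_cosets G P) (gset_cosets G H)"
  have X: "fin_gset G ?X" using sub by (intro fin_gset_prod fin_gset_cosets)
  have "p_subgroup p (stabilizer G (snd ?X) z) G" if z: "z \<in> fst ?X" for z
  proof -
    let ?K = "stabilizer G (snd ?X) z"
    have K: "subgroup ?K G" using X z by (rule stabilizer_subgroup)
    have "z \<in> gset_fixed ?K ?X" using K z by (simp add: gset_fixed_iff_stabilizer)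
    then have "gset_fixed ?K (gset_cosets G P) \<noteq> {}" by (auto simp: gset_fixed_prod)
    moreover have "finite (gset_fixed ?K (gset_cosets G P))"
      using fin_gset_cosets[OF sub(1)] by (simp add: fin_gset_finite finite_gset_fixed)
    ultimately have "marks G (gset_cosets G P) ?K \<noteq> 0" using K by (simp add: marks_def)
    then obtain g where "g \<in> carrier G" "?K \<subseteq> conjugate g P"
      by (rule marks_cosets_nonzero[OF sub(1) K])
    then show ?thesis using subgroup_of_p_subgroup[OF p p_subgroup_conjugate[OF P] K] by blast
  qed
  then obtain c where c: "c \<in> carrier (burnside_p p G)" "ghost G c = marks G ?X"
    using marks_p_isotropy[OF X] by blast
  then have "trans_class G P \<otimes>\<^bsub>burnside G\<^esub> trans_class G H = c"
    using sub burnside_p_subset[of p]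
    by (intro eqI) (auto simp: ghost_simps trans_class_closed ghost_trans_class marks_prod)
  then show ?thesis using c by simp
qed

lemma burnside_p_mult_closed:
  assumes p: "prime p" and c: "c \<in> carrier (burnside_p p G)" and d: "d \<in> carrier (burnside_p p G)"
  shows "c \<otimes>\<^bsub>burnside G\<^esub> d \<in> carrier (burnside_p p G)"
proof -
  interpret cring "burnside G" by (rule cring_burnside)
  note closed = subsetD[OF burnside_p_subset, of _ p]
  have trans_d: "trans_class G P \<otimes>\<^bsub>burnside G\<^esub> d \<in> carrier (burnside_p p G)"
    if P: "p_subgroup p P G" for P
    using d
  proof (induction rule: burnside_p_induct)
    case zero
    then show ?case using burnside_p_zero closed[OF burnside_p_trans_class[OF P]] by simp
  next
    case (trans H)
    then show ?case by (rule trans_class_mult_closed[OF p P])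
  next
    case (neg c)
    then show ?case
      using closed[OF burnside_p_trans_class[OF P]] closed by (simp add: r_minus burnside_p_neg)
  next
    case (add c d)
    then show ?case
      using closed[OF burnside_p_trans_class[OF P]] closed by (simp add: r_distr burnside_p_add)
  qed
  show ?thesis using c
  proof (induction rule: burnside_p_induct)
    case zero
    then show ?case using burnside_p_zero closed[OF d] by simp
  next
    case (trans H)
    then show ?case by (rule trans_d)
  next
    case (neg c)
    then show ?case using closed closed[OF d] by (simp add: l_minus burnside_p_neg)
  next
    case (add c e)
    then show ?case using closed closed[OF d] by (simp add: l_distr burnside_p_add)
  qed
qed

text \<open>A subgroup with a fixed point in \<open>G/H\<close> lies in a conjugate of \<open>H\<close>, so it is a \<open>p\<close>-group if \<open>H\<close>
  is.\<close>

lemma ghost_burnside_p_zero: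
  assumes p: "prime p" and c: "c \<in> carrier (burnside_p p G)" and Q: "\<not> p_subgroup p Q G"
  shows "ghost G c Q = 0"
proof -
  interpret ghost_embedding "burnside G" "ghost G" by (rule ghost_embedding_burnside)
  note closed = subsetD[OF burnside_p_subset, of _ p]
  from c show ?thesis
  proof (induction rule: burnside_p_induct)
    case (trans H)
    have H: "subgroup H G" using trans by (simp add: p_subgroup_def)
    show ?case
    proof (rule ccontr)
      assume nz: "ghost G (trans_class G H) Q \<noteq> 0"
      then have Q': "subgroup Q G" by (auto simp: ghost_def split: if_splits)
      obtain g where "g \<in> carrier G" "Q \<subseteq> conjugate g H"
        using marks_cosets_nonzero[OF H Q'] nz by (metis ghost_trans_class[OF H])
      then show False
        using subgroup_of_p_subgroup[OF p p_subgroup_conjugate[OF trans] Q'] Q by blast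
    qed
  qed (simp_all add: ghost_zero ghost_add closed ghost_a_inv[OF cring_burnside])
qed

text \<open>Only the marks at subgroups of \<open>S\<close> are kept, as these are the ones that elements of \<open>A(S)\<close> have.\<close>

definition sylow_ghost :: "'a set \<Rightarrow> 'a virt \<Rightarrow> 'a set \<Rightarrow> rat" where
  "sylow_ghost S c Q = (if Q \<subseteq> S then ghost G c Q else 0)"

text \<open>Nothing is lost by this: at other subgroups the marks of elements of \<open>A(G;p)\<close> vanish or, by Sylow's
  theorem, agree with a mark at a subgroup of \<open>S\<close>.\<close>

theorem ghost_embedding_burnside_p:
  assumes p: "prime p" and S: "sylow_subgroup p S G"
  shows "ghost_embedding (burnside_p p G) (sylow_ghost S)"
proof -
  interpret ghost_embedding "burnside G" "ghost G" by (rule ghost_embedding_burnside)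
  note closed = subsetD[OF burnside_p_subset, of _ p]
  have ops: "\<zero>\<^bsub>burnside_p p G\<^esub> = \<zero>\<^bsub>burnside G\<^esub>" "add (burnside_p p G) = add (burnside G)"
    "monoid.mult (burnside_p p G) = monoid.mult (burnside G)" by (simp_all add: burnside_p_def)
  have "inj_on (sylow_ghost S) (carrier (burnside_p p G))"
  proof (rule inj_onI)
    fix c d assume c: "c \<in> carrier (burnside_p p G)" and d: "d \<in> carrier (burnside_p p G)"
      and eq: "sylow_ghost S c = sylow_ghost S d"
    have "ghost G c Q = ghost G d Q" for Q
    proof (cases "p_subgroup p Q G")
      case True
      then have Q: "subgroup Q G" by (simp add: p_subgroup_def)
      obtain g where g: "g \<in> carrier G" "conjugate g Q \<subseteq> S"
        using sylow_conjugate[OF p S True] .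
      have "ghost G c (conjugate g Q) = ghost G d (conjugate g Q)"
        using fun_cong[OF eq, of "conjugate g Q"] g by (simp add: sylow_ghost_def)
      then show ?thesis using ghost_conjugate[OF closed g(1) Q] c d by simp
    next
      case False
      then show ?thesis using ghost_burnside_p_zero[OF p] c d by simp
    qed
    then show "c = d" using c d closed by (intro eqI) auto
  qed
  moreover have "\<exists>d\<in>carrier (burnside_p p G). sylow_ghost S d = - sylow_ghost S c"
    if "c \<in> carrier (burnside_p p G)" for c
    using that burnside_p_neg closed ghost_a_inv[OF cring_burnside]
    by (intro bexI[of _ "\<ominus>\<^bsub>burnside G\<^esub> c"]) (auto simp: sylow_ghost_def fun_eq_iff)
  ultimately show ?thesis
    unfolding ghost_embedding_def ops
    using burnside_p_zero burnside_p_add burnside_p_mult_closed[OF p] closed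
    by (auto simp: sylow_ghost_def fun_eq_iff ghost_zero ghost_add ghost_mult)
qed

end


section \<open>Restriction along homomorphisms\<close>

text \<open>The points of a pulled back set that are fixed by \<open>Q\<close> are those fixed by \<open>f(Q)\<close>. So marks of
  the pullback depend on marks only, and restriction is well defined on classes.\<close>

lemma burnside_res_gset_diff:
  fixes H :: "('h, 'm) monoid_scheme" and K :: "('k, 'n) monoid_scheme"
  assumes H: "finite_group H" and K: "finite_group K" and f: "f \<in> hom H K"
    and X: "fin_gset K X" "fin_gset K Y"
  shows "burnside_res H f (gset_diff K X Y) = gset_diff H (gset_pullback f X) (gset_pullback f Y)"
proof -
  interpret H: finite_group H by fact
  interpret K: finite_group K by fact
  interpret f: group_hom H K f using f by unfold_locales
  note pullback = K.fin_gset_pullback[OF _ H.is_group f]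
  have marks: "marks H (gset_pullback f Z) Q = (if subgroup Q H then marks K Z (f ` Q) else 0)"
    for Z :: "('k, 'e) gset" and Q
    by (simp add: marks_def gset_fixed_pullback f.subgroup_img_is_subgroup)
  have "gset_diff H (gset_pullback f X') (gset_pullback f Y')
      = gset_diff H (gset_pullback f X) (gset_pullback f Y)"
    if "(X', Y') \<in> gset_diff K X Y" for X' Y'
  proof (rule H.gset_diff_cong)
    have *: "fin_gset K X'" "fin_gset K Y'" "marks K X' - marks K Y' = marks K X - marks K Y"
      using that X by (simp_all add: K.mem_gset_diff_iff)
    then show "fin_gset H (gset_pullback f X')" "fin_gset H (gset_pullback f Y')"
      by (simp_all add: pullback)
    show "marks H (gset_pullback f X') - marks H (gset_pullback f Y')
        = marks H (gset_pullback f X) - marks H (gset_pullback f Y)"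
      using fun_cong[OF *(3)] by (simp add: fun_eq_iff marks)
  qed (simp_all add: pullback X)
  then show ?thesis
    unfolding burnside_res_def using K.gset_diff_nonempty[OF X] by (intro UN_eq_const) auto
qed

lemma ghost_burnside_res:
  fixes H :: "('h, 'm) monoid_scheme" and K :: "('k, 'n) monoid_scheme"
  assumes H: "finite_group H" and K: "finite_group K" and f: "f \<in> hom H K"
    and c: "c \<in> carrier (burnside K)"
  shows "burnside_res H f c \<in> carrier (burnside H)"
    and "ghost H (burnside_res H f c) Q = (if subgroup Q H then ghost K c (f ` Q) else 0)"
proof -
  interpret H: finite_group H by fact
  interpret K: finite_group K by fact
  interpret f: group_hom H K f using f by unfold_locales
  obtain X Y :: "('k, nat) gset" where X: "fin_gset K X" "fin_gset K Y" "c = gset_diff K X Y"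
    using c by (rule K.burnsideE)
  note pullback = K.fin_gset_pullback[OF _ H.is_group f]
  show "burnside_res H f c \<in> carrier (burnside H)"
    using X by (simp add: burnside_res_gset_diff[OF H K f] H.gset_diff_closed pullback)
  show "ghost H (burnside_res H f c) Q = (if subgroup Q H then ghost K c (f ` Q) else 0)"
    using X by (simp add: burnside_res_gset_diff[OF H K f] H.ghost_gset_diff K.ghost_gset_diff pullback
      marks_def gset_fixed_pullback f.subgroup_img_is_subgroup)
qed

lemma loc_ghost_res:
  fixes H :: "('h, 'm) monoid_scheme" and K :: "('k, 'n) monoid_scheme"
  assumes p: "prime p" and H: "finite_group H" and K: "finite_group K" and f: "f \<in> hom H K"
    and x: "x \<in> carrier (localize p (burnside K))"
  shows "loc_res p H f x \<in> carrier (localize p (burnside H))"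
    and "loc_ghost (ghost H) (loc_res p H f x) Q
      = (if subgroup Q H then loc_ghost (ghost K) x (f ` Q) else 0)"
proof -
  interpret H: ghost_embedding "burnside H" "ghost H"
    using H by (rule finite_group.ghost_embedding_burnside)
  interpret K: ghost_embedding "burnside K" "ghost K"
    using K by (rule finite_group.ghost_embedding_burnside)
  obtain a n where x_eq: "x = loc_frac p (burnside K) a n" and a: "a \<in> carrier (burnside K)" "coprime n p"
    using x by (rule K.localize_carrierE)
  note res = ghost_burnside_res[OF H K f]
  have "loc_frac p (burnside H) (burnside_res H f b) m = loc_frac p (burnside H) (burnside_res H f a) n"
    if "(b, m) \<in> x" for b m
  proof -
    have *: "b \<in> carrier (burnside K)" "coprime m p"
        "\<And>Q. ghost K b Q / of_nat m = ghost K a Q / of_nat n"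
      using that a by (simp_all add: x_eq K.mem_loc_frac_iff[OF p])
    then show ?thesis
      using a by (intro H.loc_frac_cong[OF p]) (simp_all add: res)
  qed
  moreover have "x \<noteq> {}"
    using K.mem_loc_frac_iff[OF p a, of a n] a by (auto simp: x_eq)
  ultimately have eq: "loc_res p H f x = loc_frac p (burnside H) (burnside_res H f a) n"
    unfolding loc_res_def by (intro UN_eq_const) auto
  show "loc_res p H f x \<in> carrier (localize p (burnside H))"
    using a by (simp add: eq H.loc_frac_closed res)
  show "loc_ghost (ghost H) (loc_res p H f x) Q
      = (if subgroup Q H then loc_ghost (ghost K) x (f ` Q) else 0)"
    unfolding eq unfolding x_eq using a by (simp add: H.loc_ghost_frac[OF p] K.loc_ghost_frac[OF p] res)
qed


section \<open>Stable elements\<close>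

locale sylow_fusion = finite_group G for G (structure) +
  fixes p :: nat and S :: "'a set"
  assumes prime: "prime p" and sylow: "sylow_subgroup p S G"
begin

abbreviation GS where "GS \<equiv> G\<lparr>carrier := S\<rparr>"

lemma subgroup_S: "subgroup S G" using sylow by (simp add: sylow_subgroup_def)

sublocale S: finite_group GS using subgroup_S by (rule finite_group_subgroup)

sublocale A: ghost_embedding "burnside GS" "ghost GS" by (rule S.ghost_embedding_burnside)

sublocale AL: ghost_embedding "localize p (burnside GS)" "loc_ghost (ghost GS)"
  by (rule A.ghost_embedding_localize[OF prime])

sublocale B: ghost_embedding "burnside_p p G" "sylow_ghost S"
  by (rule ghost_embedding_burnside_p[OF prime sylow])

sublocale BL: ghost_embedding "localize p (burnside_p p G)" "loc_ghost (sylow_ghost S)"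
  by (rule B.ghost_embedding_localize[OF prime])

abbreviation AF where "AF \<equiv> burnside_fusion p G S"
abbreviation \<Phi> where "\<Phi> \<equiv> loc_ghost (ghost GS)"
abbreviation \<Psi> where "\<Psi> \<equiv> loc_ghost (sylow_ghost S)"

definition subs :: "'a set set" where "subs = {Q. subgroup Q G \<and> Q \<subseteq> S}"

text \<open>The function of the identity of \<open>A(S)\<close>, which is to become the identity of \<open>A(G;p)\<^sub>(\<^sub>p\<^sub>)\<close> as well.\<close>

definition unit_ghost :: "'a set \<Rightarrow> rat" where "unit_ghost Q = (if Q \<in> subs then 1 else 0)"

lemma subs_iff: "Q \<in> subs \<longleftrightarrow> subgroup Q GS"
  by (simp add: subs_def subgroup_of_subgroup_iff subgroup_S)

lemma finite_subs: "finite subs"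
  by (rule finite_subset[of _ "Pow S"]) (auto simp: subs_def finite_subgroup subgroup_S)

lemma ghost_S_outside: "Q \<notin> subs \<Longrightarrow> ghost GS a Q = 0"
  by (simp add: ghost_def subs_iff)

lemma sylow_ghost_outside: "Q \<notin> subs \<Longrightarrow> sylow_ghost S c Q = 0"
  by (auto simp: sylow_ghost_def ghost_def subs_def)

lemma \<Phi>_outside: "\<lbrakk>x \<in> carrier (localize p (burnside GS)); Q \<notin> subs\<rbrakk> \<Longrightarrow> \<Phi> x Q = 0"
  by (elim A.localize_carrierE) (simp add: A.loc_ghost_frac[OF prime] ghost_S_outside)

lemma \<Psi>_outside: "\<lbrakk>y \<in> carrier (localize p (burnside_p p G)); Q \<notin> subs\<rbrakk> \<Longrightarrow> \<Psi> y Q = 0"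
  by (elim B.localize_carrierE) (simp add: B.loc_ghost_frac[OF prime] sylow_ghost_outside)

lemma loc_mark_eq: "Q \<in> subs \<Longrightarrow> loc_mark Q x = \<Phi> x Q"
  by (simp add: loc_mark_def loc_ghost_def ghost_def subs_iff)

definition conj_invariant :: "('a set \<Rightarrow> rat) \<Rightarrow> bool" where
  "conj_invariant f \<longleftrightarrow>
     (\<forall>Q\<in>subs. \<forall>g\<in>carrier G. conjugate g Q \<in> subs \<longrightarrow> f (conjugate g Q) = f Q)"

lemma conjugate_in_subs:
  "\<lbrakk>Q \<in> subs; g \<in> carrier G\<rbrakk> \<Longrightarrow> conjugate g Q \<in> subs \<longleftrightarrow> conjugate g Q \<subseteq> S"
  by (auto simp: subs_def subgroup_conjugate)

lemma conj_invariant_fusion_class: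
  assumes "conj_invariant f" "Q \<in> subs" "Q' \<in> fusion_class G S Q"
  shows "f Q' = f Q"
proof -
  have "subgroup Q G" using assms(2) by (simp add: subs_def)
  then obtain g where "g \<in> carrier G" "Q' = conjugate g Q" "Q' \<subseteq> S"
    using assms(3) by (auto simp: fusion_class_iff)
  then show ?thesis
    using assms(1,2) conjugate_in_subs by (simp add: conj_invariant_def)
qed

text \<open>The restriction of \<open>x\<close> to \<open>P\<close> along conjugation by \<open>g\<close> has at \<open>Q\<close> the mark of \<open>x\<close> at
  \<open>g Q g\<^sup>-\<^sup>1\<close>. Elements of \<open>A(P)\<^sub>(\<^sub>p\<^sub>)\<close> with the same marks are equal, which turns the equation between
  restrictions into equations between marks.\<close>

lemma fusion_stable_iff:
  assumes x: "x \<in> carrier (localize p (burnside GS))"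
  shows "fusion_stable p G S x \<longleftrightarrow> conj_invariant (\<Phi> x)"
proof -
  have res_eq_iff: "loc_res p (G\<lparr>carrier := P\<rparr>) (\<lambda>y\<in>P. g \<otimes> y \<otimes> inv g) x
        = loc_res p (G\<lparr>carrier := P\<rparr>) (\<lambda>y\<in>P. y) x
      \<longleftrightarrow> (\<forall>Q. subgroup Q G \<and> Q \<subseteq> P \<longrightarrow> \<Phi> x (conjugate g Q) = \<Phi> x Q)"
    if P: "P \<in> subs" and g: "g \<in> carrier G" and gP: "conjugate g P \<subseteq> S" for P g
  proof -
    let ?P = "G\<lparr>carrier := P\<rparr>"
    have PG: "subgroup P G" "P \<subseteq> S" "P \<subseteq> carrier G"
      using P subgroup.subset by (auto simp: subs_def)
    interpret P: finite_group ?P using PG(1) by (rule finite_group_subgroup)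
    interpret PL: ghost_embedding "localize p (burnside ?P)" "loc_ghost (ghost ?P)"
      using P.ghost_embedding_burnside prime by (rule ghost_embedding.ghost_embedding_localize)
    have gS: "g \<otimes> y \<otimes> inv g \<in> S" if "y \<in> P" for y
      using that gP by (auto simp: conjugate_def)
    have hom: "(\<lambda>y\<in>P. g \<otimes> y \<otimes> inv g) \<in> hom ?P GS" "(\<lambda>y\<in>P. y) \<in> hom ?P GS"
      using hom_mult[OF conjugation_hom[OF g]] PG(2,3) gS subgroup.m_closed[OF PG(1)]
      by (auto intro!: homI simp: subset_iff)
    have image: "(\<lambda>y\<in>P. g \<otimes> y \<otimes> inv g) ` Q = conjugate g Q" "(\<lambda>y\<in>P. y) ` Q = Q"
      if "Q \<subseteq> P" for Q
      using that by (auto simp: conjugate_def image_iff subset_iff)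
    note res = loc_ghost_res[OF prime P.finite_group_axioms S.finite_group_axioms _ x]
    have "loc_res p ?P (\<lambda>y\<in>P. g \<otimes> y \<otimes> inv g) x = loc_res p ?P (\<lambda>y\<in>P. y) x
      \<longleftrightarrow> (\<forall>Q. loc_ghost (ghost ?P) (loc_res p ?P (\<lambda>y\<in>P. g \<otimes> y \<otimes> inv g) x) Q
              = loc_ghost (ghost ?P) (loc_res p ?P (\<lambda>y\<in>P. y) x) Q)"
      using res(1)[OF hom(1)] res(1)[OF hom(2)] PL.eqI by (auto simp: fun_eq_iff)
    also have "\<dots> \<longleftrightarrow> (\<forall>Q. subgroup Q G \<and> Q \<subseteq> P \<longrightarrow> \<Phi> x (conjugate g Q) = \<Phi> x Q)"
      unfolding res(2)[OF hom(1)] res(2)[OF hom(2)] subgroup_of_subgroup_iff[OF PG(1)]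
    proof (intro iff_allI)
      fix Q
      show "(if subgroup Q G \<and> Q \<subseteq> P then \<Phi> x ((\<lambda>y\<in>P. g \<otimes> y \<otimes> inv g) ` Q) else 0)
          = (if subgroup Q G \<and> Q \<subseteq> P then \<Phi> x ((\<lambda>y\<in>P. y) ` Q) else 0)
        \<longleftrightarrow> (subgroup Q G \<and> Q \<subseteq> P \<longrightarrow> \<Phi> x (conjugate g Q) = \<Phi> x Q)"
        by (cases "subgroup Q G"; cases "Q \<subseteq> P")
          (simp_all only: image simp_thms if_True if_False)
    qed
    finally show ?thesis .
  qed
  show ?thesis
  proof
    assume stable: "fusion_stable p G S x"
    show "conj_invariant (\<Phi> x)"
      unfolding conj_invariant_def
    proof (intro ballI impI)
      fix Q g assume Q: "Q \<in> subs" and g: "g \<in> carrier G" and gQ: "conjugate g Q \<in> subs"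
      then have sub: "subgroup Q G" "Q \<subseteq> S" "conjugate g Q \<subseteq> S" by (simp_all add: subs_def)
      have "(\<lambda>y\<in>Q. g \<otimes> y \<otimes> inv g) \<in> fusion_mor G Q S"
        using g sub(3) by (auto simp: fusion_mor_iff)
      then have "loc_res p (G\<lparr>carrier := Q\<rparr>) (\<lambda>y\<in>Q. g \<otimes> y \<otimes> inv g) x
          = loc_res p (G\<lparr>carrier := Q\<rparr>) (\<lambda>y\<in>Q. y) x"
        using stable sub(1,2) by (simp add: fusion_stable_def)
      then show "\<Phi> x (conjugate g Q) = \<Phi> x Q"
        using res_eq_iff[OF Q g sub(3)] sub(1) by blast
    qed
  next
    assume inv: "conj_invariant (\<Phi> x)"
    show "fusion_stable p G S x"
      unfolding fusion_stable_def
    proof (intro allI impI ballI)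
      fix P \<phi> assume P: "subgroup P G \<and> P \<subseteq> S" and "\<phi> \<in> fusion_mor G P S"
      then obtain g where g: "g \<in> carrier G" "conjugate g P \<subseteq> S"
        and \<phi>: "\<phi> = (\<lambda>y\<in>P. g \<otimes> y \<otimes> inv g)" by (auto simp: fusion_mor_iff)
      have P': "P \<in> subs" using P by (simp add: subs_def)
      have "\<Phi> x (conjugate g Q) = \<Phi> x Q" if Q: "subgroup Q G" "Q \<subseteq> P" for Q
      proof -
        have "Q \<in> subs" using Q P by (auto simp: subs_def)
        moreover have "conjugate g Q \<subseteq> S" using conjugate_mono[OF Q(2), of g] g(2) by (rule order_trans)
        ultimately show ?thesis
          using inv g conjugate_in_subs by (simp add: conj_invariant_def)
      qed
      then show "loc_res p (G\<lparr>carrier := P\<rparr>) \<phi> x = loc_res p (G\<lparr>carrier := P\<rparr>) (\<lambda>y\<in>P. y) x"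
        unfolding \<phi> using res_eq_iff[OF P' g] by blast
    qed
  qed
qed

lemma AF_iff:
  "x \<in> carrier AF \<longleftrightarrow> x \<in> carrier (localize p (burnside GS)) \<and> conj_invariant (\<Phi> x)"
  using fusion_stable_iff by (auto simp: burnside_fusion_def)

lemma AF_one: "\<one>\<^bsub>AF\<^esub> \<in> carrier AF" "\<Phi> \<one>\<^bsub>AF\<^esub> = unit_ghost"
proof -
  have one: "\<one>\<^bsub>AF\<^esub> = loc_frac p (burnside GS) \<one>\<^bsub>burnside GS\<^esub> 1"
    by (simp add: burnside_fusion_def localize_def)
  show \<Phi>: "\<Phi> \<one>\<^bsub>AF\<^esub> = unit_ghost"
    unfolding one by (simp add: A.loc_ghost_frac[OF prime] S.burnside_one unit_ghost_def subs_iff fun_eq_iff)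
  have "\<one>\<^bsub>AF\<^esub> \<in> carrier (localize p (burnside GS))"
    unfolding one by (rule A.loc_frac_closed) (simp_all add: S.burnside_one)
  then show "\<one>\<^bsub>AF\<^esub> \<in> carrier AF"
    by (simp add: AF_iff \<Phi>) (simp add: conj_invariant_def unit_ghost_def)
qed

sublocale AF: ghost_embedding AF \<Phi>
proof -
  let ?A = "{x \<in> carrier (localize p (burnside GS)). fusion_stable p G S x}"
  have iff: "x \<in> ?A \<longleftrightarrow> x \<in> carrier (localize p (burnside GS)) \<and> conj_invariant (\<Phi> x)" for x
    using fusion_stable_iff by auto
  show "ghost_embedding AF \<Phi>"
    unfolding burnside_fusion_def
  proof (rule AL.ghost_embedding_subset)
    fix x assume "x \<in> ?A"
    then obtain y where "y \<in> carrier (localize p (burnside GS))" "\<Phi> y = - \<Phi> x" "conj_invariant (\<Phi> x)"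
      using AL.neg_closed iff by blast
    then show "\<exists>y\<in>?A. \<Phi> y = - \<Phi> x"
      by (intro bexI[of _ y]) (simp_all only: iff, simp_all add: conj_invariant_def)
  qed (simp_all only: iff AL.ghost_simps, auto simp: conj_invariant_def)
qed

lemma AF_divide:
  assumes "x \<in> carrier AF" "coprime n p"
  shows "\<exists>y\<in>carrier AF. \<Phi> y = (\<lambda>Q. \<Phi> x Q / of_nat n)"
proof -
  obtain a m where x: "x = loc_frac p (burnside GS) a m" and a: "a \<in> carrier (burnside GS)" "coprime m p"
    using assms(1) by (auto simp: AF_iff elim: A.localize_carrierE)
  define y where "y = loc_frac p (burnside GS) a (m * n)"
  have y: "y \<in> carrier (localize p (burnside GS))" "\<Phi> y = (\<lambda>Q. \<Phi> x Q / of_nat n)"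
    using a assms(2) by (simp_all add: y_def x A.loc_frac_closed A.loc_ghost_frac[OF prime])
  moreover from this have "conj_invariant (\<Phi> y)"
    using assms(1) by (simp add: AF_iff conj_invariant_def)
  ultimately show ?thesis by (auto simp: AF_iff)
qed

lemma cring_AF: "cring AF"
  using \<Phi>_outside
  by (intro AF.cring AF_one(1)) (auto simp: fun_eq_iff AF_one(2) unit_ghost_def AF_iff)

text \<open>Let \<open>f\<close> be the function of \<open>x\<close>. For a finite set \<open>T\<close> of natural numbers, expanding the product of the \<open>t - f\<close> over
  \<open>t \<in> T\<close> gives \<open>\<Prod>T - f q\<close> with \<open>q\<close> in the ring. If \<open>T\<close> is the set of values of \<open>f\<close>, the product is
  zero, hence \<open>f q = \<Prod>T\<close>, and \<open>\<Prod>T\<close> may be divided by since it is prime to \<open>p\<close>.\<close>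

lemma AF_inverse:
  assumes x: "x \<in> carrier AF" and w: "\<And>Q. Q \<in> subs \<Longrightarrow> \<Phi> x Q = of_nat (w Q) \<and> coprime (w Q) p"
  shows "\<exists>y\<in>carrier AF. \<Phi> x * \<Phi> y = unit_ghost"
proof -
  have poly: "\<exists>y\<in>carrier AF. \<forall>Q\<in>subs.
      (\<Prod>t\<in>T. of_nat t - \<Phi> x Q) = of_nat (\<Prod>T) - \<Phi> x Q * \<Phi> y Q" if "finite T" for T :: "nat set"
    using that
  proof (induction T rule: finite_induct)
    case empty
    show ?case by (rule bexI[of _ "\<zero>\<^bsub>AF\<^esub>"]) (simp_all add: AF.ghost_simps)
  next
    case (insert t T)
    then obtain y where y: "y \<in> carrier AF" "\<And>Q. Q \<in> subs \<Longrightarrow>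
      (\<Prod>t\<in>T. of_nat t - \<Phi> x Q) = of_nat (\<Prod>T) - \<Phi> x Q * \<Phi> y Q" by blast
    obtain z where z: "z \<in> carrier AF" "\<Phi> z = - (\<Phi> x * \<Phi> y)"
      using AF.neg_closed[OF AF.mult_closed[OF x y(1)]] x y by (auto simp: AF.ghost_mult)
    (* (t - f) (N - f q) = t N - f (N + t q - f q), where N is the product of T *)
    let ?y = "([(\<Prod>T)] \<cdot>\<^bsub>AF\<^esub> \<one>\<^bsub>AF\<^esub> \<oplus>\<^bsub>AF\<^esub> [t] \<cdot>\<^bsub>AF\<^esub> y) \<oplus>\<^bsub>AF\<^esub> z"
    have closed: "[(\<Prod>T)] \<cdot>\<^bsub>AF\<^esub> \<one>\<^bsub>AF\<^esub> \<in> carrier AF" "[t] \<cdot>\<^bsub>AF\<^esub> y \<in> carrier AF"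
      using AF_one(1) y(1) by (simp_all add: AF.ghost_nat_multiple)
    have \<Phi>y: "\<Phi> ?y Q = of_nat (\<Prod>T) + of_nat t * \<Phi> y Q - \<Phi> x Q * \<Phi> y Q" if "Q \<in> subs" for Q
      using that closed AF_one y(1) z
      by (simp add: AF.ghost_add AF.add_closed AF.ghost_nat_multiple(2) unit_ghost_def)
    have "(\<Prod>t\<in>insert t T. of_nat t - \<Phi> x Q) = of_nat (\<Prod>(insert t T)) - \<Phi> x Q * \<Phi> ?y Q"
      if "Q \<in> subs" for Q
    proof -
      have "(\<Prod>t\<in>insert t T. of_nat t - \<Phi> x Q)
          = (of_nat t - \<Phi> x Q) * (of_nat (\<Prod>T) - \<Phi> x Q * \<Phi> y Q)"
        unfolding y(2)[OF that, symmetric] using insert.hyps by simp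
      also have "\<dots> = of_nat t * of_nat (\<Prod>T) - \<Phi> x Q * \<Phi> ?y Q"
        unfolding \<Phi>y[OF that] by (simp only: algebra_simps)
      also have "of_nat t * of_nat (\<Prod>T) = (of_nat (\<Prod>(insert t T)) :: rat)"
        using insert.hyps by simp
      finally show ?thesis .
    qed
    moreover have "?y \<in> carrier AF" using y z closed by (simp add: AF.add_closed)
    ultimately show ?case by blast
  qed
  define T where "T = w ` subs"
  have T: "finite T" by (simp add: T_def finite_subs)
  obtain y where y: "y \<in> carrier AF"
      "\<And>Q. Q \<in> subs \<Longrightarrow> (\<Prod>t\<in>T. of_nat t - \<Phi> x Q) = of_nat (\<Prod>T) - \<Phi> x Q * \<Phi> y Q"
    using poly[OF T] by blast
  have coprime: "coprime (\<Prod>T) p"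
    using w by (intro prod_coprime_left) (auto simp: T_def)
  then obtain z where z: "z \<in> carrier AF" "\<Phi> z = (\<lambda>Q. \<Phi> y Q / of_nat (\<Prod>T))"
    using AF_divide[OF y(1)] by blast
  have "\<Phi> x Q * \<Phi> z Q = unit_ghost Q" for Q
  proof (cases "Q \<in> subs")
    case True
    then have "(\<Prod>t\<in>T. of_nat t - \<Phi> x Q) = 0"
      using w[OF True] T by (intro prod_zero bexI[of _ "w Q"]) (simp_all add: T_def)
    then have "\<Phi> x Q * \<Phi> y Q = of_nat (\<Prod>T)" using y(2)[OF True] by simp
    moreover have "\<Prod>T \<noteq> 0" by (rule coprime_prime_nonzero[OF prime coprime])
    ultimately show ?thesis using True unfolding z(2) unit_ghost_def by (simp del: of_nat_prod)
  next
    case False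
    then show ?thesis using x \<Phi>_outside by (simp add: unit_ghost_def AF_iff)
  qed
  then show ?thesis using z(1) by (auto simp: fun_eq_iff)
qed


section \<open>Comparison of the two rings\<close>

text \<open>Restriction of \<open>G\<close>-sets to \<open>S\<close>. The marks of a \<open>G\<close>-set are invariant under conjugation in \<open>G\<close>, so
  the result is stable.\<close>

lemma restrict_to_AF:
  assumes "y \<in> carrier (localize p (burnside_p p G))"
  shows "\<exists>x\<in>carrier AF. \<Phi> x = \<Psi> y"
proof -
  obtain c n where y: "y = loc_frac p (burnside_p p G) c n" and c: "c \<in> carrier (burnside_p p G)" "coprime n p"
    using assms by (rule B.localize_carrierE)
  have c': "c \<in> carrier (burnside G)" using c(1) burnside_p_subset by blast
  then obtain X Y :: "('a, nat) gset" where X: "fin_gset G X" "fin_gset G Y" "c = gset_diff G X Y"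
    by (rule burnsideE)
  define a where "a = gset_diff GS X Y"
  have XS: "fin_gset GS X" "fin_gset GS Y" using X(1,2) by (simp_all add: fin_gset_subgroup subgroup_S)
  have a: "a \<in> carrier (burnside GS)" unfolding a_def using XS by (rule S.gset_diff_closed)
  have ghost: "ghost GS a = sylow_ghost S c"
    using X XS by (auto simp: fun_eq_iff a_def S.ghost_gset_diff sylow_ghost_def ghost_gset_diff marks_def
        subgroup_of_subgroup_iff subgroup_S)
  define x where "x = loc_frac p (burnside GS) a n"
  have x: "x \<in> carrier (localize p (burnside GS))" "\<Phi> x = (\<lambda>Q. sylow_ghost S c Q / of_nat n)"
    using a c by (simp_all add: x_def A.loc_frac_closed A.loc_ghost_frac[OF prime] ghost)
  moreover have "\<Psi> y = (\<lambda>Q. sylow_ghost S c Q / of_nat n)"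
    using c by (simp add: y B.loc_ghost_frac[OF prime])
  moreover have "conj_invariant (\<lambda>Q. sylow_ghost S c Q / of_nat n)"
    using ghost_conjugate[OF c'] by (simp add: conj_invariant_def sylow_ghost_def subs_def)
  ultimately show ?thesis by (intro bexI[of _ x]) (simp_all add: AF_iff)
qed

abbreviation trans_p where "trans_p P \<equiv> trans_class_p p G P"

lemma p_subgroup_subs: "P \<in> subs \<Longrightarrow> p_subgroup p P G"
  using subgroup_of_p_subgroup[OF prime _ _, of S P] sylow
  by (auto simp: subs_def p_subgroup_def sylow_subgroup_def)

lemma S_in_subs: "S \<in> subs" by (simp add: subs_def subgroup_S)

lemma trans_p_closed: "P \<in> subs \<Longrightarrow> trans_p P \<in> carrier (localize p (burnside_p p G))"
  unfolding trans_class_p_def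
  by (rule B.loc_frac_closed) (simp_all add: burnside_p_trans_class p_subgroup_subs)

lemma \<Psi>_trans_p:
  assumes "P \<in> subs" "Q \<in> subs"
  shows "\<Psi> (trans_p P) Q = marks G (gset_cosets G P) Q"
  using assms burnside_p_trans_class[OF p_subgroup_subs[OF assms(1)]]
  by (simp add: trans_class_p_def B.loc_ghost_frac[OF prime] sylow_ghost_def ghost_trans_class subs_def)

lemma \<Psi>_trans_p_S:
  assumes "Q \<in> subs"
  shows "\<Psi> (trans_p S) Q = of_nat (card (gset_fixed Q (gset_cosets G S)))"
    "coprime (card (gset_fixed Q (gset_cosets G S))) p"
  using assms \<Psi>_trans_p[OF S_in_subs assms] sylow_fixed_points[OF prime sylow p_subgroup_subs[OF assms]]
  by (auto simp: marks_def subs_def coprime_commute prime_imp_coprime_nat prime)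

text \<open>Induction \<open>[S/P] \<mapsto> [G/P]\<close>. Both sides are additive in \<open>a\<close>, so the case of transitive sets,
  which is \<open>marks_cosets_average\<close>, implies the general one.\<close>

lemma induce_marks:
  assumes "a \<in> carrier (burnside GS)"
  shows "\<exists>c\<in>carrier (burnside_p p G). \<forall>Q\<in>subs. of_nat (card (fusion_class G S Q)) * sylow_ghost S c Q
      = marks G (gset_cosets G S) Q * (\<Sum>Q'\<in>fusion_class G S Q. ghost GS a Q')"
proof -
  define T where "T f \<longleftrightarrow> (\<exists>c\<in>carrier (burnside_p p G). \<forall>Q\<in>subs.
      of_nat (card (fusion_class G S Q)) * sylow_ghost S c Q
      = marks G (gset_cosets G S) Q * (\<Sum>Q'\<in>fusion_class G S Q. f Q'))" for f :: "'a set \<Rightarrow> rat"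
  have add: "T (f + g)" if f: "T f" and g: "T g" for f g
  proof -
    obtain c d where "c \<in> carrier (burnside_p p G)" "d \<in> carrier (burnside_p p G)"
      "\<forall>Q\<in>subs. of_nat (card (fusion_class G S Q)) * sylow_ghost S c Q
        = marks G (gset_cosets G S) Q * (\<Sum>Q'\<in>fusion_class G S Q. f Q')"
      "\<forall>Q\<in>subs. of_nat (card (fusion_class G S Q)) * sylow_ghost S d Q
        = marks G (gset_cosets G S) Q * (\<Sum>Q'\<in>fusion_class G S Q. g Q')"
      using f g unfolding T_def by blast
    then show ?thesis
      unfolding T_def
      by (intro bexI[of _ "c \<oplus>\<^bsub>burnside_p p G\<^esub> d"])
        (simp_all add: B.ghost_simps sum.distrib distrib_left)
  qed
  have neg: "T (- f)" if f: "T f" for f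
  proof -
    obtain c where c: "c \<in> carrier (burnside_p p G)"
      "\<forall>Q\<in>subs. of_nat (card (fusion_class G S Q)) * sylow_ghost S c Q
        = marks G (gset_cosets G S) Q * (\<Sum>Q'\<in>fusion_class G S Q. f Q')"
      using f unfolding T_def by blast
    obtain d where "d \<in> carrier (burnside_p p G)" "sylow_ghost S d = - sylow_ghost S c"
      using B.neg_closed[OF c(1)] by blast
    with c(2) show ?thesis
      unfolding T_def by (intro bexI[of _ d]) (simp_all add: sum_negf)
  qed
  have cosets: "T (marks GS (gset_cosets GS P))" if P: "P \<in> subs" for P
    unfolding T_def
  proof (intro bexI ballI)
    show "trans_class G P \<in> carrier (burnside_p p G)"
      using P by (simp add: burnside_p_trans_class p_subgroup_subs)
    show "of_nat (card (fusion_class G S Q)) * sylow_ghost S (trans_class G P) Q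
      = marks G (gset_cosets G S) Q * (\<Sum>Q'\<in>fusion_class G S Q. marks GS (gset_cosets GS P) Q')"
      if Q: "Q \<in> subs" for Q
      using marks_cosets_average[OF subgroup_S, of P Q] P Q
      by (simp add: subs_def sylow_ghost_def ghost_trans_class)
  qed
  have "T (marks GS X)" if X: "fin_gset GS X" for X :: "('a, nat) gset"
  proof (rule S.marks_orbit_induct[OF X])
    show "T 0"
      unfolding T_def by (intro bexI[of _ "\<zero>\<^bsub>burnside_p p G\<^esub>"]) (simp_all add: B.ghost_simps)
    show "T (marks GS (gset_cosets GS (stabilizer GS (snd X) x)) + f)" if "x \<in> fst X" "T f" for x f
      using that S.stabilizer_subgroup[OF X] by (intro add cosets) (auto simp: subs_iff)
  qed
  then have "T (marks GS X - marks GS Y)" if "fin_gset GS X" "fin_gset GS Y" for X Y :: "('a, nat) gset"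
    using that add[OF _ neg] by (metis add_uminus_conv_diff)
  moreover obtain X Y :: "('a, nat) gset" where "fin_gset GS X" "fin_gset GS Y" "a = gset_diff GS X Y"
    using assms by (rule S.burnsideE)
  ultimately have "T (ghost GS a)" by (simp add: S.ghost_gset_diff)
  then show ?thesis unfolding T_def .
qed

text \<open>For stable \<open>x\<close> the average over the fusion class in \<open>induce_marks\<close> is the mark itself.\<close>

lemma induce_from_AF:
  assumes x: "x \<in> carrier AF"
  shows "\<exists>y\<in>carrier (localize p (burnside_p p G)). \<Psi> y = \<Psi> (trans_p S) * \<Phi> x"
proof -
  have inv: "conj_invariant (\<Phi> x)" and x': "x \<in> carrier (localize p (burnside GS))"
    using x by (simp_all add: AF_iff)
  obtain a n where x_eq: "x = loc_frac p (burnside GS) a n" and a: "a \<in> carrier (burnside GS)" "coprime n p"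
    using x' by (rule A.localize_carrierE)
  obtain c where c: "c \<in> carrier (burnside_p p G)"
    "\<And>Q. Q \<in> subs \<Longrightarrow> of_nat (card (fusion_class G S Q)) * sylow_ghost S c Q
      = marks G (gset_cosets G S) Q * (\<Sum>Q'\<in>fusion_class G S Q. ghost GS a Q')"
    using induce_marks[OF a(1)] by blast
  define y where "y = loc_frac p (burnside_p p G) c n"
  have y: "y \<in> carrier (localize p (burnside_p p G))" "\<Psi> y = (\<lambda>Q. sylow_ghost S c Q / of_nat n)"
    using c(1) a(2) by (simp_all add: y_def B.loc_frac_closed B.loc_ghost_frac[OF prime])
  have "\<Psi> y Q = (\<Psi> (trans_p S) * \<Phi> x) Q" for Q
  proof (cases "Q \<in> subs")
    case True
    let ?C = "fusion_class G S Q"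
    have "Q \<in> ?C" using True by (simp add: subs_def fusion_class_self)
    then have C: "card ?C \<noteq> 0" using finite_fusion_class[OF subgroup_S] by auto
    have \<Phi>: "\<Phi> x Q' = ghost GS a Q' / of_nat n" for Q'
      using a by (simp add: x_eq A.loc_ghost_frac[OF prime])
    have "(\<Sum>Q'\<in>?C. ghost GS a Q') / of_nat n = (\<Sum>Q'\<in>?C. \<Phi> x Q')"
      by (simp add: \<Phi> sum_divide_distrib)
    also have "\<dots> = of_nat (card ?C) * \<Phi> x Q"
      using conj_invariant_fusion_class[OF inv True] by simp
    finally have avg: "(\<Sum>Q'\<in>?C. ghost GS a Q') / of_nat n = of_nat (card ?C) * \<Phi> x Q" .
    have "of_nat (card ?C) * \<Psi> y Q
        = marks G (gset_cosets G S) Q * ((\<Sum>Q'\<in>?C. ghost GS a Q') / of_nat n)"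
      using c(2)[OF True] by (simp add: y(2))
    also have "\<dots> = of_nat (card ?C) * (\<Psi> (trans_p S) Q * \<Phi> x Q)"
      unfolding avg by (simp add: \<Psi>_trans_p[OF S_in_subs True])
    finally have "of_nat (card ?C) * \<Psi> y Q = of_nat (card ?C) * (\<Psi> (trans_p S) Q * \<Phi> x Q)" .
    then show ?thesis using C by simp
  next
    case False
    then show ?thesis using y(1) x' \<Psi>_outside \<Phi>_outside by simp
  qed
  then show ?thesis using y(1) by (auto simp: fun_eq_iff)
qed

lemma inverse_trans_p:
  "\<exists>v\<in>carrier AF. \<Psi> (trans_p S) * \<Phi> v = unit_ghost"
proof -
  obtain x where x: "x \<in> carrier AF" "\<Phi> x = \<Psi> (trans_p S)"
    using restrict_to_AF[OF trans_p_closed[OF S_in_subs]] by blast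
  then show ?thesis
    using AF_inverse[OF x(1), of "\<lambda>Q. card (gset_fixed Q (gset_cosets G S))"] \<Psi>_trans_p_S by simp
qed

text \<open>With \<open>u\<close> the function of \<open>[G/S]\<close> and \<open>v\<close> its inverse, every stable function \<open>f\<close> is \<open>u (v f)\<close>, and
  multiples of \<open>u\<close> come from induction.\<close>

theorem ghost_image_eq: "\<Phi> ` carrier AF = \<Psi> ` carrier (localize p (burnside_p p G))"
proof (intro equalityI subsetI)
  fix f assume "f \<in> \<Psi> ` carrier (localize p (burnside_p p G))"
  then show "f \<in> \<Phi> ` carrier AF" using restrict_to_AF by force
next
  fix f assume "f \<in> \<Phi> ` carrier AF"
  then obtain x where x: "x \<in> carrier AF" "f = \<Phi> x" by blast
  obtain v where v: "v \<in> carrier AF" "\<Psi> (trans_p S) * \<Phi> v = unit_ghost"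
    using inverse_trans_p by blast
  obtain y where y: "y \<in> carrier (localize p (burnside_p p G))"
      "\<Psi> y = \<Psi> (trans_p S) * \<Phi> (v \<otimes>\<^bsub>AF\<^esub> x)"
    using induce_from_AF[OF AF.mult_closed[OF v(1) x(1)]] by blast
  have "\<Psi> y = unit_ghost * \<Phi> x"
    using y(2) v x by (simp add: AF.ghost_mult mult.assoc[symmetric])
  also have "\<dots> = f"
    using x \<Phi>_outside by (auto simp: fun_eq_iff unit_ghost_def AF_iff)
  finally show "f \<in> \<Psi> ` carrier (localize p (burnside_p p G))" using y(1) by blast
qed

text \<open>The averaged marks that define \<open>\<beta>\<^sub>P\<close> are those of \<open>[G/P]\<close> divided by those of \<open>[G/S]\<close>. As \<open>[G/S]\<close> is
  invertible among stable functions, this quotient is the function of a stable element, and marks determine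
  that element.\<close>

lemma ghost_beta:
  assumes P: "P \<in> subs"
  shows "beta p G S P \<in> carrier AF" and "\<Psi> (trans_p S) * \<Phi> (beta p G S P) = \<Psi> (trans_p P)"
proof -
  let ?avg = "\<lambda>Q. (\<Sum>Q'\<in>fusion_class G S Q.
             loc_mark Q' (loc_frac p (burnside GS) (trans_class GS P) 1))
          / of_nat (card (fusion_class G S Q))"
  let ?b = "\<lambda>x. x \<in> carrier AF \<and>
     (\<forall>Q. subgroup Q G \<and> Q \<subseteq> S \<longrightarrow> loc_mark Q x = ?avg Q)"
  have avg: "\<Psi> (trans_p S) Q * ?avg Q = \<Psi> (trans_p P) Q" if Q: "Q \<in> subs" for Q
  proof -
    let ?C = "fusion_class G S Q"
    have "Q \<in> ?C" using Q by (simp add: subs_def fusion_class_self)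
    then have C: "card ?C \<noteq> 0" using finite_fusion_class[OF subgroup_S] by auto
    have PS: "subgroup P GS" using P by (simp add: subs_iff)
    have "loc_mark Q' (loc_frac p (burnside GS) (trans_class GS P) 1)
        = marks GS (gset_cosets GS P) Q'" if "Q' \<in> ?C" for Q'
      using that PS S.trans_class_closed[OF PS]
      by (subst loc_mark_eq)
        (auto simp: subs_def fusion_class_def A.loc_ghost_frac[OF prime] S.ghost_trans_class)
    then have "\<Psi> (trans_p S) Q * (\<Sum>Q'\<in>?C. loc_mark Q' (loc_frac p (burnside GS) (trans_class GS P) 1))
        = of_nat (card ?C) * \<Psi> (trans_p P) Q"
      using marks_cosets_average[OF subgroup_S, of P Q] P Q S_in_subs
      by (simp add: \<Psi>_trans_p) (simp add: subs_def)
    then show ?thesis using C by simp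
  qed
  have nz: "\<Psi> (trans_p S) Q \<noteq> 0" if Q: "Q \<in> subs" for Q
    using \<Psi>_trans_p_S[OF Q] coprime_prime_nonzero[OF prime] by auto
  obtain v where v: "v \<in> carrier AF" "\<Psi> (trans_p S) * \<Phi> v = unit_ghost"
    using inverse_trans_p by blast
  obtain z where z: "z \<in> carrier AF" "\<Phi> z = \<Psi> (trans_p P)"
    using restrict_to_AF[OF trans_p_closed[OF P]] by blast
  let ?x = "v \<otimes>\<^bsub>AF\<^esub> z"
  have x: "?x \<in> carrier AF" using v z by (simp add: AF.mult_closed)
  have \<Phi>x: "\<Psi> (trans_p S) Q * \<Phi> ?x Q = \<Psi> (trans_p P) Q" if Q: "Q \<in> subs" for Q
  proof -
    have "\<Psi> (trans_p S) Q * \<Phi> v Q = 1"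
      using fun_cong[OF v(2), of Q] Q by (simp add: unit_ghost_def)
    then show ?thesis using v z by (simp add: AF.ghost_mult mult.assoc[symmetric])
  qed
  have "?b ?x"
  proof (intro conjI x allI impI)
    fix Q assume "subgroup Q G \<and> Q \<subseteq> S"
    then have Q: "Q \<in> subs" by (simp add: subs_def)
    have "\<Psi> (trans_p S) Q * \<Phi> ?x Q = \<Psi> (trans_p S) Q * ?avg Q"
      using \<Phi>x[OF Q] avg[OF Q] by (rule trans[OF _ sym])
    then have "\<Phi> ?x Q = ?avg Q" using mult_left_cancel[OF nz[OF Q]] by blast
    then show "loc_mark Q ?x = ?avg Q" unfolding loc_mark_eq[OF Q] .
  qed
  moreover have "y = ?x" if y: "?b y" for y
  proof (rule AF.eqI)
    show "\<Phi> y = \<Phi> ?x"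
    proof
      fix Q
      show "\<Phi> y Q = \<Phi> ?x Q"
      proof (cases "Q \<in> subs")
        case True
        then have "loc_mark Q y = loc_mark Q ?x"
          using y \<open>?b ?x\<close> by (simp add: subs_def)
        then show ?thesis using True by (simp add: loc_mark_eq)
      next
        case False
        then show ?thesis using y x \<Phi>_outside by (simp add: AF_iff)
      qed
    qed
  qed (use y x in auto)
  ultimately have "beta p G S P = ?x"
    unfolding beta_def by (rule the_equality)
  moreover have "\<Psi> (trans_p S) * \<Phi> ?x = \<Psi> (trans_p P)"
  proof
    fix Q show "(\<Psi> (trans_p S) * \<Phi> ?x) Q = \<Psi> (trans_p P) Q"
      using \<Phi>x x \<Phi>_outside \<Psi>_outside trans_p_closed[OF P]
      by (cases "Q \<in> subs") (simp_all add: AF_iff)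
  qed
  ultimately show "beta p G S P \<in> carrier AF" "\<Psi> (trans_p S) * \<Phi> (beta p G S P) = \<Psi> (trans_p P)"
    using x by simp_all
qed

end

theorem proposition4p12:
  fixes G :: "('a, 'm) monoid_scheme" and p :: nat and S :: "'a set"
  assumes "group G" and "finite (carrier G)" and "prime p" and "sylow_subgroup p S G"
  shows "\<exists>e. let R = (localize p (burnside_p p G))\<lparr>one := e\<rparr>;
                 AF = burnside_fusion p G S
             in cring R \<and> trans_class_p p G S \<in> Units R \<and> cring AF \<and>
                (\<exists>h\<in>ring_iso AF R. \<forall>P. subgroup P G \<and> P \<subseteq> S \<longrightarrow>
                   h (beta p G S P) = trans_class_p p G P \<otimes>\<^bsub>R\<^esub> inv\<^bsub>R\<^esub> trans_class_p p G S)"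
proof -
  interpret sylow_fusion G p S
    using assms by (simp add: sylow_fusion_def sylow_fusion_axioms_def finite_group_def finite_group_axioms_def)
  have "unit_ghost \<in> \<Psi> ` carrier (localize p (burnside_p p G))"
    using imageI[OF AF_one(1), of \<Phi>] unfolding ghost_image_eq AF_one(2) .
  then obtain e where e: "e \<in> carrier (localize p (burnside_p p G))" "\<Psi> e = unit_ghost" by auto
  define R where "R = (localize p (burnside_p p G))\<lparr>one := e\<rparr>"
  have carrier_R: "carrier R = carrier (localize p (burnside_p p G))" and one_R: "\<one>\<^bsub>R\<^esub> = e"
    by (simp_all add: R_def)
  interpret R: ghost_embedding R \<Psi>
    unfolding R_def by (rule BL.ghost_embedding_one_update)
  have "cring R"
    using e \<Psi>_outside by (intro R.cring) (auto simp: carrier_R one_R fun_eq_iff unit_ghost_def)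
  then interpret R: cring R .
  let ?u = "trans_p S"
  have u: "?u \<in> carrier R" using trans_p_closed S_in_subs by (simp add: carrier_R)
  obtain v where v: "v \<in> carrier AF" "\<Psi> ?u * \<Phi> v = unit_ghost" using inverse_trans_p by blast
  have "\<Phi> v \<in> \<Psi> ` carrier R"
    using imageI[OF v(1), of \<Phi>] unfolding ghost_image_eq carrier_R .
  then obtain w where w: "w \<in> carrier R" "\<Psi> w = \<Phi> v" by (elim imageE) simp
  have "?u \<otimes>\<^bsub>R\<^esub> w = \<one>\<^bsub>R\<^esub>"
  proof (rule R.eqI)
    show "\<Psi> (?u \<otimes>\<^bsub>R\<^esub> w) = \<Psi> \<one>\<^bsub>R\<^esub>"
      unfolding R.ghost_mult[OF u w(1)] w(2) v(2) one_R e(2) ..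
  qed (use u w(1) in simp_all)
  then have unit: "?u \<in> Units R"
    using u w R.m_comm by (auto simp: Units_def)
  have image: "\<Phi> ` carrier AF = \<Psi> ` carrier R"
    unfolding carrier_R by (rule ghost_image_eq)
  have ones: "\<one>\<^bsub>R\<^esub> \<in> carrier R" "\<Phi> \<one>\<^bsub>AF\<^esub> = \<Psi> \<one>\<^bsub>R\<^esub>"
    using e AF_one(2) by (simp_all only: carrier_R one_R)
  obtain h where h: "h \<in> ring_iso AF R" "\<And>a. a \<in> carrier AF \<Longrightarrow> \<Psi> (h a) = \<Phi> a"
    by (rule ghost_ring_iso[OF AF.ghost_embedding_axioms R.ghost_embedding_axioms image
          AF_one(1) ones]) blast
  have "h (beta p G S P) = trans_p P \<otimes>\<^bsub>R\<^esub> inv\<^bsub>R\<^esub> ?u" if "subgroup P G \<and> P \<subseteq> S" for P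
  proof -
    have P: "P \<in> subs" using that by (simp add: subs_def)
    have b: "h (beta p G S P) \<in> carrier R"
      using h(1) ghost_beta(1)[OF P] by (auto simp: ring_iso_def ring_hom_def)
    have "?u \<otimes>\<^bsub>R\<^esub> h (beta p G S P) = trans_p P"
    proof (rule R.eqI)
      show "\<Psi> (?u \<otimes>\<^bsub>R\<^esub> h (beta p G S P)) = \<Psi> (trans_p P)"
        unfolding R.ghost_mult[OF u b] h(2)[OF ghost_beta(1)[OF P]] by (rule ghost_beta(2)[OF P])
      show "trans_p P \<in> carrier R" unfolding carrier_R by (rule trans_p_closed[OF P])
    qed (use u b in simp)
    then have "trans_p P \<otimes>\<^bsub>R\<^esub> inv\<^bsub>R\<^esub> ?u = (?u \<otimes>\<^bsub>R\<^esub> inv\<^bsub>R\<^esub> ?u) \<otimes>\<^bsub>R\<^esub> h (beta p G S P)"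
      using b u R.Units_inv_closed[OF unit] by (metis R.m_assoc R.m_comm)
    then show ?thesis using b R.Units_r_inv[OF unit] by simp
  qed
  then have "cring R \<and> ?u \<in> Units R \<and> cring AF \<and>
      (\<exists>h\<in>ring_iso AF R. \<forall>P. subgroup P G \<and> P \<subseteq> S \<longrightarrow>
         h (beta p G S P) = trans_p P \<otimes>\<^bsub>R\<^esub> inv\<^bsub>R\<^esub> ?u)"
    using \<open>cring R\<close> unit cring_AF h(1) by blast
  then show ?thesis
    unfolding R_def Let_def by (rule exI)
qed

end
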